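(* For any $c_v>1$, there is an online $(c_a\log n\log m,\ c_v\log n\log m)$-scheme, not necessarily with perfect completeness, for counting the number of triangles in a graph on $n$ nodes and $m$ edges, where $c_a=m n c_v^{-1/2}$. The scheme is valid in the strict turnstile update model.
   Context: Graph streams: an $n$-vertex graph is given by a stream of updates $(e,\delta)$ where $e$ is a pair of vertices and $\delta\in\mathbb Z$; in the strict turnstile model all edge multiplicities always remain nonnegative; the final graph has $m$ edges. The goal is to output the number of triangles. Schemes: a scheme for $F$ is a pair $(\mathfrak h,V)$. A prover with private randomness $r_P$ supplies after the $i$th stream element an annotation string $\mathfrak h_i$; the verifier $V$ is a streaming algorithm with $w$ bits of memory and private randomness $r_V$ reading the interleaved annotated stream and outputting a value or $\bot$. Completeness error $\delta_c$: for all inputs, $\Pr_{r_P,r_V}[\text{output}\ne F]\le\delta_c$. Soundness error $\delta_s$: for all inputs and all annotation sequences, $\Pr_{r_V}[\text{output}\notin\{F,\bot\}]\le\delta_s$. An online $(c_a,c_v)$-scheme has total annotation length $O(c_a)$, space $O(c_v)$, error $\max\{\delta_s,\delta_c\}\le1/3$, and each $\mathfrak h_i$ depends only on the first $i$ stream elements and $r_P$. *)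

theory Defs
  imports "HOL-Probability.Probability"
begin

section \<open>Annotated data streams and schemes\<close>

text \<open>Annotation is read bit by bit, so that annotation strings longer than the
  verifier's memory make sense; the verifier can tell annotation bits from stream elements.\<close>

datatype 'a token = Elem 'a | Bit bool

definition annotated_stream :: "'a list \<Rightarrow> bool list list \<Rightarrow> 'a token list" where
  "annotated_stream \<sigma> hs = concat (map2 (\<lambda>x h. Elem x # map Bit h) \<sigma> hs)"

text \<open>\<open>annot P r \<sigma> i\<close> is the string supplied after the \<open>i\<close>-th element (\<open>1 \<le> i \<le> length \<sigma>\<close>)
  of \<open>\<sigma>\<close> when the prover's private random string is \<open>r\<close>.\<close>

record 'a prover =
  coins :: "bool list pmf"
  annot :: "bool list \<Rightarrow> 'a list \<Rightarrow> nat \<Rightarrow> bool list"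

definition annotations :: "'a prover \<Rightarrow> bool list \<Rightarrow> 'a list \<Rightarrow> bool list list" where
  "annotations P r \<sigma> = map (annot P r \<sigma>) [1..<Suc (length \<sigma>)]"

text \<open>Stream lengths are not fixed in advance, so the prover is also told when the stream has
  ended: at time \<open>i\<close> it knows the first \<open>i\<close> elements, its coins, and whether the \<open>i\<close>-th element
  is the last one. On streams of any fixed length the last item carries no information, and the
  condition says that the \<open>i\<close>-th string depends only on the first \<open>i\<close> elements and on \<open>r\<close>.\<close>

definition online :: "'a prover \<Rightarrow> bool" where
  "online P \<longleftrightarrow>
    (\<forall>r \<sigma> \<sigma>' i. 1 \<le> i \<and> i \<le> length \<sigma> \<and> i \<le> length \<sigma>'
        \<and> take i \<sigma> = take i \<sigma>' \<and> (i = length \<sigma> \<longleftrightarrow> i = length \<sigma>')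
      \<longrightarrow> annot P r \<sigma> i = annot P r \<sigma>' i)"

text \<open>The verifier is a (non-uniform) one-pass algorithm whose whole memory between two tokens is
  a string of \<open>memory\<close> bits. Its private randomness is the family of independent coins tossed in
  the initial state and at each step; coins needed again later must be kept in memory
  and are charged to \<open>memory\<close>. The output \<open>None\<close> stands for rejection.\<close>

record ('a, 'b) verifier =
  memory :: nat
  init :: "bool list pmf"
  step :: "'a token \<Rightarrow> bool list \<Rightarrow> bool list pmf"
  out :: "bool list \<Rightarrow> 'b option"

definition valid_verifier :: "('a, 'b) verifier \<Rightarrow> bool" where
  "valid_verifier V \<longleftrightarrow>
    (\<forall>s \<in> set_pmf (init V). length s = memory V) \<and>
    (\<forall>t s. length s = memory V \<longrightarrow> (\<forall>s' \<in> set_pmf (step V t s). length s' = memory V))"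

primrec run :: "('a, 'b) verifier \<Rightarrow> 'a token list \<Rightarrow> bool list \<Rightarrow> bool list pmf" where
  "run V [] s = return_pmf s"
| "run V (t # ts) s = bind_pmf (step V t s) (run V ts)"

definition verifier_output :: "('a, 'b) verifier \<Rightarrow> 'a token list \<Rightarrow> 'b option pmf" where
  "verifier_output V ts = map_pmf (out V) (bind_pmf (init V) (run V ts))"

definition honest_output :: "'a prover \<Rightarrow> ('a, 'b) verifier \<Rightarrow> 'a list \<Rightarrow> 'b option pmf" where
  "honest_output P V \<sigma> =
    bind_pmf (coins P) (\<lambda>r. verifier_output V (annotated_stream \<sigma> (annotations P r \<sigma>)))"

definition completeness_error_le ::
  "'a list set \<Rightarrow> ('a list \<Rightarrow> 'b) \<Rightarrow> 'a prover \<Rightarrow> ('a, 'b) verifier \<Rightarrow> real \<Rightarrow> bool" where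
  "completeness_error_le X F P V \<delta> \<longleftrightarrow>
    (\<forall>\<sigma>\<in>X. measure_pmf.prob (honest_output P V \<sigma>) {y. y \<noteq> Some (F \<sigma>)} \<le> \<delta>)"

definition soundness_error_le ::
  "'a list set \<Rightarrow> ('a list \<Rightarrow> 'b) \<Rightarrow> ('a, 'b) verifier \<Rightarrow> real \<Rightarrow> bool" where
  "soundness_error_le X F V \<delta> \<longleftrightarrow>
    (\<forall>\<sigma>\<in>X. \<forall>hs. length hs = length \<sigma> \<longrightarrow>
      measure_pmf.prob (verifier_output V (annotated_stream \<sigma> hs)) {y. y \<notin> {Some (F \<sigma>), None}} \<le> \<delta>)"

text \<open>\<open>(P, V)\<close> is an online scheme for \<open>F\<close> on the inputs \<open>X\<close>, with at most \<open>a\<close> bits of annotation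
  in total and at most \<open>v\<close> bits of verifier memory.\<close>

definition online_scheme ::
  "'a list set \<Rightarrow> ('a list \<Rightarrow> 'b) \<Rightarrow> real \<Rightarrow> real \<Rightarrow> 'a prover \<Rightarrow> ('a, 'b) verifier \<Rightarrow> bool" where
  "online_scheme X F a v P V \<longleftrightarrow>
    online P \<and>
    (\<forall>\<sigma>\<in>X. \<forall>r \<in> set_pmf (coins P). real (\<Sum>h\<leftarrow>annotations P r \<sigma>. length h) \<le> a) \<and>
    valid_verifier V \<and> real (memory V) \<le> v \<and>
    completeness_error_le X F P V (1 / 3) \<and>
    soundness_error_le X F V (1 / 3)"


section \<open>Graph streams\<close>

text \<open>The vertices are \<open>0, \<dots>, n - 1\<close>; an edge is a two-element set of vertices.\<close>

type_synonym graph_update = "nat set \<times> int"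

definition vertex_pairs :: "nat \<Rightarrow> nat set set" where
  "vertex_pairs n = {e. e \<subseteq> {..<n} \<and> card e = 2}"

definition multiplicity_of :: "graph_update list \<Rightarrow> nat set \<Rightarrow> int" where
  "multiplicity_of \<sigma> e = (\<Sum>(e', \<delta>)\<leftarrow>\<sigma>. if e' = e then \<delta> else 0)"

definition final_edges :: "graph_update list \<Rightarrow> nat set set" where
  "final_edges \<sigma> = {e. multiplicity_of \<sigma> e > 0}"

text \<open>Strict turnstile streams whose final graph is a (simple) graph on \<open>n\<close> nodes with \<open>m\<close> edges.
  Before the end of the stream the multiplicities may be arbitrary nonnegative integers.\<close>

definition strict_turnstile_streams :: "nat \<Rightarrow> nat \<Rightarrow> graph_update list set" where
  "strict_turnstile_streams n m = {\<sigma>.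
    (\<forall>(e, \<delta>) \<in> set \<sigma>. e \<in> vertex_pairs n) \<and>
    (\<forall>i \<le> length \<sigma>. \<forall>e. multiplicity_of (take i \<sigma>) e \<ge> 0) \<and>
    (\<forall>e. multiplicity_of \<sigma> e \<le> 1) \<and>
    card (final_edges \<sigma>) = m}"

definition triangles :: "nat set set \<Rightarrow> nat set set" where
  "triangles E = {T. card T = 3 \<and> (\<forall>e. e \<subseteq> T \<and> card e = 2 \<longrightarrow> e \<in> E)}"

definition triangle_count :: "graph_update list \<Rightarrow> nat" where
  "triangle_count \<sigma> = card (triangles (final_edges \<sigma>))"

end

theory Submission
  imports Defs "HOL-Computational_Algebra.Computational_Algebra"
begin

text \<open>Split the vertices into groups of about \<open>sqrt c\<^sub>v\<close> vertices. For every pair of groups the prover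
  lists the edges between them, which the verifier stores as a bit matrix, and then for every vertex
  \<open>w\<close> the neighbours of \<open>w\<close> in the two groups, so that the verifier can count the triangles through
  \<open>w\<close> and the pair of groups. Every edge is sent once for each of the \<open>n / sqrt c\<^sub>v\<close> partner groups.
  The slots an honest prover must use are a linear function of the edge indicator vector, and they
  are sent in increasing order; hence it suffices to compare a polynomial fingerprint of the listed
  slots, modulo a prime polynomial in \<open>n\<close>, with the same fingerprint computed from the stream. If
  \<open>c\<^sub>v \<ge> n\<^sup>2\<close> the verifier can store the parities of all multiplicities instead.\<close>

text \<open>Each edge occurs in many slots, and a dishonest prover could let its copies disagree.
  Instead of local consistency tests, one fingerprint of the whole list is compared with the one
  that the final graph demands. Linearity keeps the latter computable under deletions: an update of
  an edge shifts all slots of that edge by the same amount. Intermediate multiplicities are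
  unbounded but enter only modulo the prime, and at the end they are 0 or 1. The increasing order
  serves twice. It excludes repetitions, so that sets are compared and their difference has
  coefficients -1, 0, 1, which no prime kills; and it makes forgetting safe, because a slot that has
  become irrelevant never becomes relevant again. The only randomness is the evaluation point, which
  is stored. For \<open>c\<^sub>v\<close> \<ge> \<open>n\<^sup>2\<close> the annotation bound is, up
  to logarithms, at most m and tends to 0 as \<open>c\<^sub>v\<close> grows, so a listing of all
  edges cannot be afforded in general. For n = 1 or m = 1 a logarithm vanishes, and a scheme without
  any memory is required.\<close>

section \<open>Primes and roots modulo a prime\<close>

text \<open>By induction along the Leibniz triangle:
  \<open>1 / ((k + 1) * (n choose (k + 1))) = 1 / (k * ((n - 1) choose k)) - 1 / (k * (n choose k))\<close>.\<close>

lemma choose_dvd_common_multiple: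
  fixes n k D :: nat
  assumes "1 \<le> k" "k \<le> n" "\<And>i. 1 \<le> i \<Longrightarrow> i \<le> n \<Longrightarrow> i dvd D"
  shows "k * (n choose k) dvd D"
proof -
  have "\<exists>z::int. real D = real_of_int z * (real k * real (n choose k))"
    using assms
  proof (induction k arbitrary: n rule: nat_induct_at_least)
    case base
    then have "n dvd D" by simp
    then obtain z where "D = n * z" by (auto elim: dvdE)
    then have "real D = real_of_int (int z) * (real 1 * real (n choose 1))" by simp
    then show ?case by blast
  next
    case (Suc k)
    then obtain n' where n: "n = Suc n'" "k \<le> n'" by (cases n) auto
    from Suc.IH[of n] Suc.prems obtain y :: int
      where y: "real D = real_of_int y * (real k * real (n choose k))" by auto
    from Suc.IH[of n'] Suc.prems n obtain z :: int
      where z: "real D = real_of_int z * (real k * real (n' choose k))" by auto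
    let ?C = "real (n' choose k)"
    have pos: "?C > 0" "real k > 0" using n Suc.hyps by auto
    have Ck: "(real n - real k) * real (n choose k) = real n * ?C"
    proof -
      have "(n - k) * (n choose k) = n * (n' choose k)"
        using binomial_absorb_comp[of n k] n by simp
      then have "real (n - k) * real (n choose k) = real n * ?C" by (metis of_nat_mult)
      then show ?thesis using n by (simp add: of_nat_diff)
    qed
    have CS: "real (Suc k) * real (n choose Suc k) = real n * ?C"
      using Suc_times_binomial[of k n'] n by (metis of_nat_mult)
    have y': "real D * (real n - real k) = real_of_int y * real k * (real n * ?C)"
      unfolding Ck[symmetric] by (subst y) simp
    have z': "real D * real n = real_of_int z * real k * (real n * ?C)"
      by (subst z) simp
    have "real D * real k = real_of_int (z - y) * (real n * ?C) * real k"
      using y' z' by (simp add: algebra_simps)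
    then have "real D = real_of_int (z - y) * (real n * ?C)" using pos by simp
    then show ?case unfolding CS[symmetric] by blast
  qed
  then obtain z :: int where "real D = real_of_int z * (real k * real (n choose k))" by blast
  then have "real_of_int (int D) = real_of_int (z * int (k * (n choose k)))" by simp
  then have "int D = z * int (k * (n choose k))" by (simp only: of_int_eq_iff)
  then have "int (k * (n choose k)) dvd int D" by simp
  then show ?thesis by (simp only: int_dvd_int_iff)
qed

text \<open>Supplies the modulus of the fingerprint. A quadratic gap is harmless, because only the
  number of bits of the prime is charged to the memory.\<close>

lemma prime_between:
  fixes N :: nat
  assumes "1 \<le> N"
  obtains p where "prime p" "N \<le> p" "p \<le> 16 * N\<^sup>2"
proof (rule ccontr)
  assume *: "\<not> thesis"
  \<comment> \<open>Now the primes up to \<open>n = 16 * N\<^sup>2\<close> are below \<open>N\<close>, so the numbers up to \<open>n\<close> have a common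
    multiple \<open>D \<le> n ^ N\<close>; this is too small for a multiple of the central binomial coefficient.\<close>
  define k where "k = 8 * N\<^sup>2"
  define n where "n = 2 * k"
  \<comment> \<open>This is the exponent of \<open>p\<close> in the least common multiple of 1, ...,
    \<open>n\<close>. Every factor \<open>p ^ e p\<close> of \<open>D\<close> is at most
    \<open>n\<close>, which bounds \<open>D\<close> by the number of primes involved.\<close>
  define e where "e p = (GREATEST i. p ^ i \<le> n)" for p :: nat
  have k: "1 \<le> k" using assms by (simp add: k_def)
  have small: "p < N" if "prime p" "p \<le> n" for p
    using * that that(2) \<open>\<And>p. \<lbrakk>prime p; N \<le> p; p \<le> 16 * N\<^sup>2\<rbrakk> \<Longrightarrow> thesis\<close>
    by (auto simp: n_def k_def not_le[symmetric])
  define Q where "Q = {p. prime p \<and> p < N}"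
  define D where "D = (\<Prod>p\<in>Q. p ^ e p)"
  have finQ: "finite Q" by (simp add: Q_def)
  have bound: "i < n + 1" if "p ^ i \<le> n" "prime p" for p i :: nat
  proof -
    have "i < 2 ^ i" by simp
    also have "\<dots> \<le> p ^ i" using that(2) prime_ge_2_nat by (simp add: power_mono)
    finally show ?thesis using that by simp
  qed
  have e1: "p ^ e p \<le> n" if "prime p" for p
    unfolding e_def
    by (rule GreatestI_nat[where k = 0 and b = "n + 1"])
      (use k that bound in \<open>auto simp: n_def intro: less_imp_le\<close>)
  have e2: "i \<le> e p" if "prime p" "p ^ i \<le> n" for p i
    unfolding e_def
    by (rule Greatest_le_nat[where b = "n + 1"]) (use that bound in \<open>auto intro: less_imp_le\<close>)
  have "i dvd D" if i: "1 \<le> i" "i \<le> n" for i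
  proof -
    have "i = (\<Prod>p\<in>prime_factors i. p ^ multiplicity p i)"
      using i by (subst prod_prime_factors) auto
    also have "\<dots> dvd (\<Prod>p\<in>prime_factors i. p ^ e p)"
    proof (rule prod_dvd_prod)
      fix p assume p: "p \<in> prime_factors i"
      have "p ^ multiplicity p i \<le> n"
        using i multiplicity_dvd[of p i] dvd_imp_le[of "p ^ multiplicity p i" i] by linarith
      then show "p ^ multiplicity p i dvd p ^ e p"
        using p by (intro le_imp_power_dvd e2) auto
    qed
    also have "\<dots> dvd D" unfolding D_def
    proof (rule prod_dvd_prod_subset[OF finQ])
      show "prime_factors i \<subseteq> Q"
      proof
        fix p assume p: "p \<in> prime_factors i"
        then have "prime p" "p dvd i" by auto
        moreover have "p \<le> n" using dvd_imp_le[OF \<open>p dvd i\<close>] i by simp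
        ultimately have "prime p" "p \<le> n" by simp_all
        then show "p \<in> Q" using small by (simp add: Q_def)
      qed
    qed
    finally show ?thesis .
  qed
  then have "k * (n choose k) dvd D"
    by (intro choose_dvd_common_multiple) (use k in \<open>auto simp: n_def\<close>)
  moreover have "D > 0" unfolding D_def Q_def
    by (intro prod_pos) (auto simp: prime_gt_0_nat)
  ultimately have "k * (n choose k) \<le> D" by (intro dvd_imp_le)
  then have "n choose k \<le> D" using k
    by (cases k) auto
  also have "D \<le> (\<Prod>p\<in>Q. n)" unfolding D_def
    by (rule prod_mono) (auto simp: Q_def e1)
  also have "\<dots> = n ^ card Q" by simp
  also have "\<dots> \<le> n ^ N"
  proof (rule power_increasing)
    have "card Q \<le> card {..<N}" by (intro card_mono) (auto simp: Q_def)
    then show "card Q \<le> N" by simp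
  qed (use k in \<open>simp add: n_def\<close>)
  finally have up: "n choose k \<le> n ^ N" .
  have "real (4 ^ k) \<le> real (n ^ Suc N)"
  proof -
    have "4 ^ k / real (2 * k) \<le> real (n choose k)"
      using central_binomial_lower_bound[of k] k by (simp add: n_def)
    then have "4 ^ k \<le> real (n choose k) * real n" using k by (simp add: n_def field_simps)
    also have "\<dots> \<le> real (n ^ N) * real n"
      by (intro mult_right_mono) (use up in \<open>simp_all only: of_nat_le_iff of_nat_0_le_iff\<close>)
    finally show ?thesis by (simp add: mult.commute)
  qed
  then have "4 ^ k \<le> n ^ Suc N" by (simp only: of_nat_le_iff)
  also have "\<dots> \<le> (2 ^ (4 + 2 * N)) ^ Suc N"
  proof (rule power_mono)
    have "N \<le> 2 ^ N" by (simp add: less_imp_le)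
    then have "N\<^sup>2 \<le> (2 ^ N)\<^sup>2" by (intro power_mono) auto
    then show "n \<le> 2 ^ (4 + 2 * N)"
      by (simp add: n_def k_def power_add power_mult[symmetric] mult.commute)
  qed simp
  also have "\<dots> = 2 ^ ((4 + 2 * N) * Suc N)" by (simp only: power_mult)
  finally have "(2::nat) ^ (2 * k) \<le> 2 ^ ((4 + 2 * N) * Suc N)" by (simp add: power_mult)
  \<comment> \<open>Source of the constant 16: the right-hand side is at most
    \<open>12 * N\<^sup>2\<close>, while the left-hand side is
    \<open>16 * N\<^sup>2\<close>.\<close>
  then have "2 * k \<le> (4 + 2 * N) * Suc N" by (simp only: power_increasing_iff)
  moreover have "N \<le> N\<^sup>2" "1 \<le> N\<^sup>2" using assms by (simp_all add: power2_eq_square)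
  moreover have "(4 + 2 * N) * Suc N = 2 * N\<^sup>2 + 6 * N + 4"
    by (simp add: algebra_simps power2_eq_square)
  ultimately show False unfolding k_def by linarith
qed

text \<open>Division by X - a leaves the remainder f(a), which \<open>p\<close> divides at a root a;
  so the quotient is again nonzero modulo \<open>p\<close>, and every root other than a is one of
  the quotient because \<open>p\<close> is prime. Integer polynomials with divisibility match the
  fingerprints, which are integer sums reduced modulo \<open>p\<close>.\<close>

lemma card_roots_mod_prime_le:
  fixes f :: "int poly" and p :: nat
  assumes "prime p" "\<exists>i. \<not> int p dvd coeff f i"
  shows "card {x\<in>{..<p}. int p dvd poly f (int x)} \<le> degree f"
  using assms(2)
proof (induction "degree f" arbitrary: f rule: less_induct)
  case less
  let ?Z = "\<lambda>f. {x\<in>{..<p}. int p dvd poly f (int x)}"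
  show ?case
  proof (cases "?Z f = {}")
    case True
    then show ?thesis by (simp only: card.empty)
  next
    case False
    then obtain a where a: "a < p" "int p dvd poly f (int a)" by auto
    define q where "q = synthetic_div f (int a)"
    have f: "f = [:- int a, 1:] * q + [:poly f (int a):]"
      unfolding q_def by (rule synthetic_div_correct'[symmetric])
    have nd: "degree f \<noteq> 0"
    proof
      assume "degree f = 0"
      then obtain c where c: "f = [:c:]" by (rule degree_eq_zeroE)
      with a have "int p dvd c" by simp
      then have "int p dvd coeff f i" for i unfolding c by (cases i) auto
      then show False using less.prems by blast
    qed
    have q: "\<exists>i. \<not> int p dvd coeff q i"
    proof (rule ccontr)
      assume "\<not> ?thesis"
      then have all: "int p dvd coeff q i" for i by blast
      have "int p dvd coeff f i" for i
        by (subst f) (use all a in \<open>cases i; simp\<close>)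
      then show False using less.prems by blast
    qed
    have dq: "degree q < degree f" using nd by (simp add: q_def degree_synthetic_div)
    have "?Z f \<subseteq> insert a (?Z q)"
    proof
      fix x assume x: "x \<in> ?Z f"
      have "poly f (int x) = (int x - int a) * poly q (int x) + poly f (int a)"
        by (subst f) (simp add: algebra_simps)
      then have "int p dvd (int x - int a) * poly q (int x)"
        using x a by (metis (no_types, lifting) dvd_add_left_iff mem_Collect_eq)
      then have "int p dvd int x - int a \<or> int p dvd poly q (int x)"
        using assms(1) by (simp add: prime_dvd_mult_iff)
      moreover have "x = a" if "int p dvd int x - int a"
      proof (rule ccontr)
        assume "x \<noteq> a"
        then have "int p \<le> \<bar>int x - int a\<bar>" using dvd_imp_le_int[OF _ that] by simp
        then show False using x a by (simp add: abs_if split: if_splits)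
      qed
      ultimately show "x \<in> insert a (?Z q)" using x by auto
    qed
    then have "card (?Z f) \<le> card (insert a (?Z q))" by (intro card_mono) auto
    also have "\<dots> \<le> Suc (card (?Z q))" by (rule card_insert_le_m1) auto
    also have "\<dots> \<le> Suc (degree q)" using less.hyps[OF dq q] by simp
    finally show ?thesis using dq by simp
  qed
qed

section \<open>Verifiers as randomised automata\<close>

text \<open>All coins are tossed at the start and live on inside the state, so they are charged to
  the memory. What remains is a deterministic automaton, whose states are numbered by bit strings of
  length \<open>M\<close>.\<close>

lemma verifier_of_automaton:
  fixes start :: "'r \<Rightarrow> 's" and next_state :: "'a token \<Rightarrow> 's \<Rightarrow> 's" and result :: "'s \<Rightarrow> 'b option"
  assumes R: "finite R" "R \<noteq> {}"
    and S: "finite S" "card S \<le> 2 ^ M"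
    and reach: "\<And>ts r. r \<in> R \<Longrightarrow> fold next_state ts (start r) \<in> S"
  obtains V :: "('a, 'b) verifier" where "valid_verifier V" "memory V = M"
    "\<And>ts. verifier_output V ts =
      map_pmf (\<lambda>r. result (fold next_state ts (start r))) (pmf_of_set R)"
proof -
  \<comment> \<open>\<open>S\<close> merely contains the reachable states and need not be closed
    under \<open>next_state\<close>; the reachable states are closed.\<close>
  define S' where "S' = {fold next_state ts (start r) | ts r. r \<in> R}"
  have S'_sub: "S' \<subseteq> S" using reach by (auto simp: S'_def)
  have start_S': "start r \<in> S'" if "r \<in> R" for r
    unfolding S'_def mem_Collect_eq using that
    by (intro exI[of _ "[]"] exI[of _ r]) simp
  have next_S': "next_state t s \<in> S'" if "s \<in> S'" for t s
  proof -
    from that obtain ts r where "s = fold next_state ts (start r)" "r \<in> R" by (auto simp: S'_def)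
    then have "next_state t s = fold next_state (ts @ [t]) (start r)" by simp
    then show ?thesis using \<open>r \<in> R\<close> unfolding S'_def by blast
  qed
  let ?B = "{bs :: bool list. length bs = M}"
  have fB: "finite ?B" using finite_lists_length_eq[of "UNIV :: bool set" M] by simp
  have cB: "card ?B = 2 ^ M" using card_lists_length_eq[of "UNIV :: bool set" M] by simp
  obtain enc where enc: "enc ` S \<subseteq> ?B" "inj_on enc S"
    using card_le_inj[OF S(1) fB] S(2) cB by auto
  define dec where "dec = the_inv_into S enc"
  have dec: "dec (enc s) = s" if "s \<in> S" for s
    using that enc(2) by (simp add: dec_def the_inv_into_f_f)
  \<comment> \<open>Strings that encode no reachable state are left fixed, since validity constrains
    the step on every string of length \<open>M\<close>.\<close>
  define V :: "('a, 'b) verifier" where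
    "V = \<lparr>memory = M, init = map_pmf (\<lambda>r. enc (start r)) (pmf_of_set R),
      step = (\<lambda>t bs. return_pmf (if bs \<in> enc ` S' then enc (next_state t (dec bs)) else bs)),
      out = (\<lambda>bs. result (dec bs))\<rparr>"
  have run: "run V ts (enc s) = return_pmf (enc (fold next_state ts s))" if "s \<in> S'" for ts s
    using that
  proof (induction ts arbitrary: s)
    case Nil then show ?case by simp
  next
    case (Cons t ts)
    have "step V t (enc s) = return_pmf (enc (next_state t s))"
      using Cons.prems dec[of s] S'_sub by (auto simp: V_def)
    then show ?case using Cons.IH[OF next_S'[OF Cons.prems]] by (simp add: bind_return_pmf)
  qed
  have "valid_verifier V"
    unfolding valid_verifier_def
  proof (intro conjI ballI allI impI)
    have len: "length (enc s) = M" if "s \<in> S'" for s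
      using that enc(1) S'_sub by blast
    show "length s = memory V" if "s \<in> set_pmf (init V)" for s
      using that R start_S' len by (auto simp: V_def)
    show "length bs' = memory V"
      if "length bs = memory V" "bs' \<in> set_pmf (step V t bs)" for t bs bs'
    proof (cases "bs \<in> enc ` S'")
      case True
      then obtain s where s: "s \<in> S'" "bs = enc s" by blast
      then have "dec bs = s" using dec S'_sub by blast
      then show ?thesis using that(2) True len[OF next_S'[OF s(1)]] by (simp add: V_def)
    next
      case False
      then show ?thesis using that by (simp add: V_def)
    qed
  qed
  moreover have "verifier_output V ts =
      map_pmf (\<lambda>r. result (fold next_state ts (start r))) (pmf_of_set R)" for ts
  proof -
    have "bind_pmf (init V) (run V ts) = bind_pmf (pmf_of_set R) (\<lambda>r. run V ts (enc (start r)))"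
      by (simp add: V_def bind_map_pmf)
    also have "\<dots> = bind_pmf (pmf_of_set R)
        (\<lambda>r. return_pmf (enc (fold next_state ts (start r))))"
      by (rule bind_pmf_cong) (use R start_S' run in auto)
    also have "\<dots> = map_pmf (\<lambda>r. enc (fold next_state ts (start r))) (pmf_of_set R)"
      by (simp add: map_pmf_def)
    finally have "verifier_output V ts =
        map_pmf (\<lambda>r. out V (enc (fold next_state ts (start r)))) (pmf_of_set R)"
      by (simp add: verifier_output_def map_pmf_comp)
    also have "\<dots> = map_pmf (\<lambda>r. result (fold next_state ts (start r))) (pmf_of_set R)"
      by (rule map_pmf_cong) (use R reach in \<open>auto simp: V_def dec\<close>)
    finally show ?thesis .
  qed
  moreover have "memory V = M" by (simp add: V_def)
  ultimately show thesis using that by blast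
qed

lemma annotated_stream_simps [simp]:
  "annotated_stream [] hs = []"
  "annotated_stream (x # \<sigma>) (h # hs) = Elem x # map Bit h @ annotated_stream \<sigma> hs"
  by (simp_all add: annotated_stream_def)

lemma fold_annotated_stream:
  assumes "length hs = length \<sigma>"
    and elem: "\<And>x a b. f (Elem x) (r, a, b) = (r, g x a, b)"
    and bit: "\<And>c a b. f (Bit c) (r, a, b) = (r, a, h c b)"
  shows "fold f (annotated_stream \<sigma> hs) (r, a, b) = (r, fold g \<sigma> a, fold h (concat hs) b)"
proof -
  have bits: "fold f (map Bit bs) (r, a, b) = (r, a, fold h bs b)" for bs a b
    by (induction bs arbitrary: b) (simp_all add: bit)
  show ?thesis using assms(1)
    by (induction hs \<sigma> arbitrary: a b rule: list_induct2) (simp_all add: elem bits)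
qed

text \<open>The stream and the annotation are processed independently by the verifier, and the honest
  prover sends its whole message after the last update.\<close>

lemma online_scheme_of_tracks:
  fixes X :: "'a list set" and F :: "'a list \<Rightarrow> 'b" and M :: nat
    and read_elem :: "'r \<Rightarrow> 'a \<Rightarrow> 'x \<Rightarrow> 'x" and read_bit :: "'r \<Rightarrow> bool \<Rightarrow> 'y \<Rightarrow> 'y"
    and result :: "'r \<Rightarrow> 'x \<Rightarrow> 'y \<Rightarrow> 'b option" and honest :: "'a list \<Rightarrow> bool list"
  assumes R: "finite R" "R \<noteq> {}"
    and Sx: "finite Sx" "\<And>r \<sigma>. r \<in> R \<Longrightarrow> fold (read_elem r) \<sigma> xinit \<in> Sx"
    and Sy: "finite Sy" "\<And>r bs. r \<in> R \<Longrightarrow> fold (read_bit r) bs yinit \<in> Sy"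
    and M: "card R * card Sx * card Sy \<le> 2 ^ M" "real M \<le> v"
    and ne: "[] \<notin> X"
    and len: "\<And>\<sigma>. \<sigma> \<in> X \<Longrightarrow> real (length (honest \<sigma>)) \<le> a"
    and complete: "\<And>\<sigma> r. \<sigma> \<in> X \<Longrightarrow> r \<in> R \<Longrightarrow>
      result r (fold (read_elem r) \<sigma> xinit) (fold (read_bit r) (honest \<sigma>) yinit) = Some (F \<sigma>)"
    and sound: "\<And>\<sigma> bs. \<sigma> \<in> X \<Longrightarrow>
      3 * card {r \<in> R. result r (fold (read_elem r) \<sigma> xinit) (fold (read_bit r) bs yinit)
        \<notin> {Some (F \<sigma>), None}} \<le> card R"
  shows "\<exists>P V. online_scheme X F a v P V"
proof -
  define nxt :: "'a token \<Rightarrow> 'r \<times> 'x \<times> 'y \<Rightarrow> 'r \<times> 'x \<times> 'y" where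
    "nxt t = (\<lambda>(r, a, b). case t of Elem x \<Rightarrow> (r, read_elem r x a, b)
      | Bit c \<Rightarrow> (r, a, read_bit r c b))" for t
  define res where "res = (\<lambda>(r, a, b). result r a b)"
  have nxt_step: "nxt (Elem x) (r, a, b) = (r, read_elem r x a, b)"
    "nxt (Bit c) (r, a, b) = (r, a, read_bit r c b)" for x c r a b
    by (simp_all add: nxt_def)
  have nxt: "fold nxt (annotated_stream \<sigma> hs) (r, xinit, yinit)
      = (r, fold (read_elem r) \<sigma> xinit, fold (read_bit r) (concat hs) yinit)"
    if "length hs = length \<sigma>" for \<sigma> hs r
    by (rule fold_annotated_stream[OF that]) (simp_all add: nxt_step)
  \<comment> \<open>The memory bound concerns arbitrary token sequences, including those that are no
    annotated stream, such as bits before the first element.\<close>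
  have any: "\<exists>\<sigma> bs. fold nxt ts (r, xinit, yinit)
      = (r, fold (read_elem r) \<sigma> xinit, fold (read_bit r) bs yinit)" for ts r
  proof (induction ts rule: rev_induct)
    case Nil
    show ?case by (rule exI[of _ "[]"], rule exI[of _ "[]"]) simp
  next
    case (snoc t ts)
    then obtain \<sigma> bs where *: "fold nxt ts (r, xinit, yinit)
      = (r, fold (read_elem r) \<sigma> xinit, fold (read_bit r) bs yinit)" by blast
    show ?case
    proof (cases t)
      case (Elem x)
      then show ?thesis using *
        by (intro exI[of _ "\<sigma> @ [x]"] exI[of _ bs]) (simp add: nxt_step)
    next
      case (Bit c)
      then show ?thesis using *
        by (intro exI[of _ \<sigma>] exI[of _ "bs @ [c]"]) (simp add: nxt_step)
    qed
  qed
  obtain V :: "('a, 'b) verifier" where V: "valid_verifier V" "memory V = M"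
    "\<And>ts. verifier_output V ts = map_pmf (\<lambda>r. res (fold nxt ts (r, xinit, yinit))) (pmf_of_set R)"
  proof (rule verifier_of_automaton[of R "R \<times> Sx \<times> Sy" M nxt "\<lambda>r. (r, xinit, yinit)" res])
    show "card (R \<times> Sx \<times> Sy) \<le> 2 ^ M" using M by (simp add: card_cartesian_product mult.assoc)
    show "fold nxt ts (r, xinit, yinit) \<in> R \<times> Sx \<times> Sy" if "r \<in> R" for ts r
      using any[of ts r] that Sx(2) Sy(2) by auto
  qed (use R Sx Sy in auto)
  have out: "verifier_output V (annotated_stream \<sigma> hs) = map_pmf
      (\<lambda>r. result r (fold (read_elem r) \<sigma> xinit) (fold (read_bit r) (concat hs) yinit)) (pmf_of_set R)"
    if "length hs = length \<sigma>" for \<sigma> hs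
    by (simp add: V(3) nxt[OF that] res_def)
  \<comment> \<open>Sending everything at the last position is online because the prover is told
    when the stream ends. The empty stream has no such position, hence the assumption
    \<open>ne\<close>.\<close>
  define P :: "'a prover" where
    "P = \<lparr>coins = return_pmf [], annot = (\<lambda>_ \<sigma> i. if i = length \<sigma> then honest \<sigma> else [])\<rparr>"
  have ann: "annotations P r \<sigma> = replicate (length \<sigma> - 1) [] @ [honest \<sigma>]" if "\<sigma> \<in> X" for r \<sigma>
  proof -
    have "\<sigma> \<noteq> []" using ne that by blast
    then obtain l where l: "length \<sigma> = Suc l" by (cases \<sigma>) auto
    have "map (annot P r \<sigma>) [1..<length \<sigma>] = map (\<lambda>_. []) [1..<length \<sigma>]"
      by (rule map_cong) (auto simp: P_def)
    then show ?thesis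
      by (simp add: annotations_def P_def l map_replicate_const)
  qed
  have cat: "concat (annotations P r \<sigma>) = honest \<sigma>" if "\<sigma> \<in> X" for r \<sigma>
    by (simp add: ann[OF that])
  have len_ann: "length (annotations P r \<sigma>) = length \<sigma>" for r \<sigma>
    by (simp add: annotations_def del: upt_Suc)
  have "online P" unfolding online_def
  proof (intro allI impI, elim conjE)
    fix r i and \<sigma> \<sigma>' :: "'a list"
    assume "take i \<sigma> = take i \<sigma>'" "i = length \<sigma> \<longleftrightarrow> i = length \<sigma>'"
    then show "annot P r \<sigma> i = annot P r \<sigma>' i"
      by (cases "i = length \<sigma>") (simp_all add: P_def)
  qed
  moreover have "real (\<Sum>h\<leftarrow>annotations P r \<sigma>. length h) \<le> a" if "\<sigma> \<in> X" for r \<sigma>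
    using len[OF that] by (simp add: cat[OF that] flip: length_concat)
  \<comment> \<open>The honest message succeeds for every \<open>r\<close>, so the error is
    0.\<close>
  moreover have "completeness_error_le X F P V (1 / 3)"
    unfolding completeness_error_le_def
  proof
    fix \<sigma> assume \<sigma>: "\<sigma> \<in> X"
    have "honest_output P V \<sigma> = verifier_output V (annotated_stream \<sigma> (annotations P [] \<sigma>))"
      by (simp add: honest_output_def P_def bind_return_pmf)
    also have "\<dots> = map_pmf (\<lambda>r. Some (F \<sigma>)) (pmf_of_set R)"
      unfolding out[OF len_ann] cat[OF \<sigma>]
      by (rule map_pmf_cong) (use R complete[OF \<sigma>] in auto)
    finally have "measure_pmf.prob (honest_output P V \<sigma>) {y. y \<noteq> Some (F \<sigma>)} = 0"
      by simp
    then show "measure_pmf.prob (honest_output P V \<sigma>) {y. y \<noteq> Some (F \<sigma>)} \<le> 1 / 3" by simp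
  qed
  moreover have "soundness_error_le X F V (1 / 3)"
    unfolding soundness_error_le_def
  proof (intro ballI allI impI)
    fix \<sigma> :: "'a list" and hs :: "bool list list"
    assume \<sigma>: "\<sigma> \<in> X" and hs: "length hs = length \<sigma>"
    let ?B = "{r \<in> R. result r (fold (read_elem r) \<sigma> xinit) (fold (read_bit r) (concat hs) yinit)
        \<notin> {Some (F \<sigma>), None}}"
    have "measure_pmf.prob (verifier_output V (annotated_stream \<sigma> hs)) {y. y \<notin> {Some (F \<sigma>), None}}
        = real (card ?B) / real (card R)"
      unfolding out[OF hs] using R
      by (simp add: measure_pmf_of_set vimage_def Int_def)
    also have "\<dots> \<le> 1 / 3"
    proof -
      have "3 * card ?B \<le> card R" by (rule sound[OF \<sigma>])
      moreover have "card R > 0" using R by (simp add: card_gt_0_iff)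
      ultimately show ?thesis by (simp add: field_simps)
    qed
    finally show "measure_pmf.prob (verifier_output V (annotated_stream \<sigma> hs))
      {y. y \<notin> {Some (F \<sigma>), None}} \<le> 1 / 3" .
  qed
  ultimately have "online_scheme X F a v P V"
    using V M by (auto simp: online_scheme_def)
  then show ?thesis by blast
qed

section \<open>Slots and their processing\<close>

datatype slot = Slot nat nat nat nat nat

fun slot_list :: "slot \<Rightarrow> nat list" where
  "slot_list (Slot i j w x y) = [i, j, w, x, y]"

lemma inj_slot_list: "slot_list s = slot_list s' \<Longrightarrow> s = s'"
  by (cases s; cases s') simp

instantiation slot :: linorder
begin

text \<open>The order of transmission: within a pair of groups the edges (\<open>w = 0\<close>)
  precede all vertices, and for each vertex the neighbours in the first group (0) precede those in
  the second (1). Thus both other slots of a path precede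
  \<open>Slot i j (Suc w) 1 v\<close>.\<close>

definition less_slot_def: "s < s' \<longleftrightarrow> (slot_list s, slot_list s') \<in> lexord less_than"

definition less_eq_slot_def:
  "s \<le> s' \<longleftrightarrow> s = s' \<or> (slot_list s, slot_list s') \<in> lexord less_than"

instance
proof
  have irr: "(l, l) \<notin> lexord less_than" for l by (rule lexord_irreflexive) simp
  have tr: "(l1, l2) \<in> lexord less_than \<Longrightarrow> (l2, l3) \<in> lexord less_than
      \<Longrightarrow> (l1, l3) \<in> lexord less_than" for l1 l2 l3
    by (rule lexord_trans) auto
  fix a b c :: slot
  show "(a < b) = (a \<le> b \<and> \<not> b \<le> a)"
    unfolding less_slot_def less_eq_slot_def using irr tr by metis
  show "a \<le> a" by (simp add: less_eq_slot_def)
  show "a \<le> b \<Longrightarrow> b \<le> c \<Longrightarrow> a \<le> c"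
    unfolding less_eq_slot_def using tr by metis
  show "a \<le> b \<Longrightarrow> b \<le> a \<Longrightarrow> a = b"
    unfolding less_eq_slot_def using irr tr by metis
  have "(slot_list a, slot_list b) \<in> lexord less_than \<or> slot_list a = slot_list b
      \<or> (slot_list b, slot_list a) \<in> lexord less_than"
    by (rule lexord_linear) auto
  then show "a \<le> b \<or> b \<le> a"
    unfolding less_eq_slot_def using inj_slot_list by blast
qed

end

lemma less_slot_simp [simp]:
  "Slot i j w x y < Slot i' j' w' x' y' \<longleftrightarrow>
    i < i' \<or> i = i' \<and> (j < j' \<or> j = j' \<and> (w < w' \<or> w = w' \<and> (x < x' \<or> x = x' \<and> y < y')))"
  by (simp add: less_slot_def)

text \<open>The verifier only remembers the slots relevant to the last one: \<open>w = 0\<close> marks the edges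
  between the groups \<open>i\<close> and \<open>j\<close>, and \<open>w = Suc x\<close> the neighbours of the vertex \<open>x\<close>.\<close>

fun relevant :: "slot \<Rightarrow> slot \<Rightarrow> bool" where
  "relevant (Slot i j w x y) (Slot i' j' w' x' y') \<longleftrightarrow> i = i' \<and> j = j' \<and> (w = 0 \<or> w = w')"

text \<open>Defined for every set of slots, since a dishonest list need not come from a graph; for
  an honest list these are the ordered triangles.\<close>

definition paths :: "slot set \<Rightarrow> (nat \<times> nat \<times> nat \<times> nat \<times> nat) set" where
  "paths Z = {(i, j, w, u, v). Slot i j 0 u v \<in> Z \<and> Slot i j (Suc w) 0 u \<in> Z
    \<and> Slot i j (Suc w) 1 v \<in> Z}"

definition paths_to :: "slot \<Rightarrow> slot set \<Rightarrow> (nat \<times> nat \<times> nat \<times> nat \<times> nat) set" where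
  "paths_to s Z = {(i, j, w, u, v). (i, j, w, u, v) \<in> paths (insert s Z) \<and> s = Slot i j (Suc w) 1 v}"

text \<open>\<open>None\<close> is permanent rejection. Comparing \<open>s\<close> with the retained
  slots alone enforces the order of the whole list, because the last slot read is always
  retained.\<close>

fun read_slot :: "slot set \<Rightarrow> slot \<Rightarrow> (slot set \<times> nat) option \<Rightarrow> (slot set \<times> nat) option" where
  "read_slot U s None = None"
| "read_slot U s (Some (A, c)) =
    (if s \<in> U \<and> (\<forall>x\<in>A. x < s)
     then Some (insert s {x \<in> A. relevant x s}, c + card (paths_to s A)) else None)"

lemma relevant_refl [simp]: "relevant s s"
  by (cases s) simp

text \<open>Forgetting is safe: a slot that will matter later still matters now. The lexicographic
  order squeezes the group indices of \<open>l\<close> and then its third component.\<close>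

lemma relevant_between:
  assumes "relevant x s" "x \<le> l" "l < s"
  shows "relevant x l"
proof -
  obtain i j w a b where x: "x = Slot i j w a b" by (cases x)
  obtain i' j' w' a' b' where l: "l = Slot i' j' w' a' b'" by (cases l)
  obtain u c d where s: "s = Slot i j u c d" "w = 0 \<or> w = u"
    using assms(1) x by (cases s) auto
  show ?thesis
  proof (cases "x = l")
    case False
    then have "x < l" using assms(2) by simp
    then have up: "i < i' \<or> i = i' \<and> (j < j' \<or> j = j' \<and> w \<le> w')"
      unfolding x l less_slot_simp by (metis less_imp_le order_refl)
    have lo: "i' < i \<or> i' = i \<and> (j' < j \<or> j' = j \<and> w' \<le> u)"
      using assms(3) unfolding s l less_slot_simp by (metis less_imp_le order_refl)
    have "i = i'" using up lo by linarith
    moreover from this have "j = j'" using up lo by linarith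
    ultimately show ?thesis using up lo s(2) unfolding x l by auto
  qed simp
qed

lemma finite_paths: "finite Z \<Longrightarrow> finite (paths Z)"
proof -
  assume "finite Z"
  let ?f = "\<lambda>(a, b). case a of Slot i j w u v \<Rightarrow> case b of Slot i' j' w' x' y' \<Rightarrow> (i, j, w' - 1, u, v)"
  have "paths Z \<subseteq> ?f ` (Z \<times> Z)"
  proof
    fix q assume "q \<in> paths Z"
    then obtain i j w u v where q: "q = (i, j, w, u, v)" "Slot i j 0 u v \<in> Z" "Slot i j (Suc w) 0 u \<in> Z"
      by (auto simp: paths_def)
    then have "q = ?f (Slot i j 0 u v, Slot i j (Suc w) 0 u)" by simp
    with q show "q \<in> ?f ` (Z \<times> Z)" by blast
  qed
  then show "finite (paths Z)" using \<open>finite Z\<close> by (meson finite_SigmaI finite_imageI finite_subset)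
qed

text \<open>\<open>Slot i j (Suc w) 1 v\<close> is the largest of the three slots of a path, so a
  new maximal slot can complete a path only in that role.\<close>

lemma paths_insert:
  assumes "\<forall>x\<in>Z. x < s"
  shows "paths (insert s Z) = paths Z \<union> paths_to s Z" "paths Z \<inter> paths_to s Z = {}"
proof -
  have "s \<notin> Z" using assms by auto
  then show "paths Z \<inter> paths_to s Z = {}" by (auto simp: paths_def paths_to_def)
  show "paths (insert s Z) = paths Z \<union> paths_to s Z"
  proof
    show "paths (insert s Z) \<subseteq> paths Z \<union> paths_to s Z"
    proof
      fix q assume "q \<in> paths (insert s Z)"
      moreover obtain i j w u v where q: "q = (i, j, w, u, v)" by (cases q)
      ultimately have mem: "Slot i j 0 u v \<in> insert s Z" "Slot i j (Suc w) 0 u \<in> insert s Z"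
        "Slot i j (Suc w) 1 v \<in> insert s Z" by (auto simp: paths_def)
      show "q \<in> paths Z \<union> paths_to s Z"
      proof (cases "Slot i j (Suc w) 1 v = s")
        case True
        then show ?thesis using mem by (auto simp: paths_to_def paths_def q)
      next
        case False
        then have lt: "Slot i j (Suc w) 1 v < s" using mem(3) assms by auto
        have "Slot i j 0 u v \<noteq> s" "Slot i j (Suc w) 0 u \<noteq> s" using lt by auto
        then show ?thesis using mem False by (auto simp: paths_def q)
      qed
    qed
  qed (auto simp: paths_def paths_to_def)
qed

text \<open>The two other slots of a path ending in \<open>s\<close> are relevant to
  \<open>s\<close>: one has third component 0, the other has that of \<open>s\<close>. So the
  increment of the counter can be computed from the retained slots.\<close>

lemma paths_to_relevant: "paths_to s {x \<in> Z. relevant x s} = paths_to s Z"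
proof -
  have "(i, j, w, u, v) \<in> paths_to s {x \<in> Z. relevant x s} \<longleftrightarrow> (i, j, w, u, v) \<in> paths_to s Z"
    for i j w u v
  proof (cases "s = Slot i j (Suc w) 1 v")
    case True
    show ?thesis unfolding True by (simp add: paths_to_def paths_def)
  next
    case False
    then show ?thesis by (simp add: paths_to_def)
  qed
  then show ?thesis by auto
qed

text \<open>Invariant that recovers the global list from the small memory. For the empty list the
  unspecified \<open>last\<close> is harmless, as the retained set is empty anyway.\<close>

lemma fold_read_slot:
  "fold (read_slot U) xs (Some ({}, 0)) =
    (if sorted_wrt (<) xs \<and> set xs \<subseteq> U
     then Some ({x \<in> set xs. relevant x (last xs)}, card (paths (set xs))) else None)"
proof (induction xs rule: rev_induct)
  case Nil
  have "paths {} = {}" by (auto simp: paths_def)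
  then show ?case by simp
next
  case (snoc s xs)
  show ?case
  proof (cases "sorted_wrt (<) xs \<and> set xs \<subseteq> U")
    case False
    then have "fold (read_slot U) (xs @ [s]) (Some ({}, 0)) = None" by (simp add: snoc)
    moreover have "\<not> (sorted_wrt (<) (xs @ [s]) \<and> set (xs @ [s]) \<subseteq> U)"
      using False by (auto simp: sorted_wrt_append)
    ultimately show ?thesis by (simp only: if_False)
  next
    case True
    define A where "A = {x \<in> set xs. relevant x (last xs)}"
    have eq: "fold (read_slot U) (xs @ [s]) (Some ({}, 0)) =
        read_slot U s (Some (A, card (paths (set xs))))"
      using True by (simp only: snoc fold_append fold_simps o_apply simp_thms if_True A_def)
    have le_last: "x \<le> last xs" if "x \<in> set xs" for x
    proof -
      from that obtain ys l where "xs = ys @ [l]" by (cases xs rule: rev_cases) auto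
      then show ?thesis using that True by (auto simp: sorted_wrt_append)
    qed
    \<comment> \<open>The maximum \<open>last xs\<close> is relevant to itself and therefore lies in
      \<open>A\<close>.\<close>
    have lt_iff: "(\<forall>x\<in>A. x < s) \<longleftrightarrow> (\<forall>x\<in>set xs. x < s)"
    proof
      assume *: "\<forall>x\<in>A. x < s"
      show "\<forall>x\<in>set xs. x < s"
      proof
        fix x assume x: "x \<in> set xs"
        then have "last xs \<in> A" by (cases xs) (auto simp: A_def)
        then have "last xs < s" using * by blast
        then show "x < s" using le_last[OF x] by simp
      qed
    qed (auto simp: A_def)
    show ?thesis
    proof (cases "s \<in> U \<and> (\<forall>x\<in>set xs. x < s)")
      case False
      then have "fold (read_slot U) (xs @ [s]) (Some ({}, 0)) = None"
        unfolding eq using lt_iff by simp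
      moreover have "\<not> (sorted_wrt (<) (xs @ [s]) \<and> set (xs @ [s]) \<subseteq> U)"
        using False by (auto simp: sorted_wrt_append)
      ultimately show ?thesis by (simp only: if_False)
    next
      case s: True
      have rel: "{x \<in> A. relevant x s} = {x \<in> set xs. relevant x s}"
      proof -
        have "relevant x (last xs)" if "x \<in> set xs" "relevant x s" for x
        proof (rule relevant_between[OF that(2) le_last[OF that(1)]])
          show "last xs < s" using s that(1) by (cases xs) auto
        qed
        then show ?thesis unfolding A_def by blast
      qed
      have "paths_to s A = paths_to s (set xs)"
        using paths_to_relevant[of s A] paths_to_relevant[of s "set xs"] rel by simp
      moreover have "card (paths (insert s (set xs))) = card (paths (set xs)) + card (paths_to s (set xs))"
      proof -
        have "finite (paths (insert s (set xs)))" by (rule finite_paths) simp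
        then show ?thesis using s by (simp add: paths_insert card_Un_disjoint)
      qed
      ultimately have "fold (read_slot U) (xs @ [s]) (Some ({}, 0)) =
          Some (insert s {x \<in> set xs. relevant x s}, card (paths (insert s (set xs))))"
        unfolding eq using lt_iff s rel by simp
      moreover have "sorted_wrt (<) (xs @ [s]) \<and> set (xs @ [s]) \<subseteq> U"
        using True s by (auto simp: sorted_wrt_append)
      moreover have "{x \<in> set (xs @ [s]). relevant x (last (xs @ [s]))} =
          insert s {x \<in> set xs. relevant x s}" by auto
      moreover have "set (xs @ [s]) = insert s (set xs)" by simp
      ultimately show ?thesis by (simp only: simp_thms if_True)
    qed
  qed
qed

section \<open>Cutting the annotation into blocks of equal length\<close>

fun read_block :: "nat \<Rightarrow> (bool list \<Rightarrow> 'c) \<Rightarrow> ('c \<Rightarrow> 'z \<Rightarrow> 'z) \<Rightarrow> bool \<Rightarrow> bool list \<times> 'z \<Rightarrow> bool list \<times> 'z" where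
  "read_block k dec g c (bs, z) =
    (if Suc (length bs) = k then ([], g (dec (bs @ [c])) z) else (bs @ [c], z))"

text \<open>Any bit string, honest or not, acts as a list of decoded blocks followed by an
  incomplete one. Both are obtained before \<open>g\<close>, hence independently of the random point
  that enters through \<open>g\<close>; soundness rests on this.\<close>

lemma fold_read_block:
  assumes "0 < k"
  obtains xs rest where "length rest < k"
    "\<And>(g :: 'c \<Rightarrow> 'z \<Rightarrow> 'z) z. fold (read_block k dec g) bs ([], z) = (rest, fold g xs z)"
proof -
  have "\<exists>xs rest. length rest < k \<and>
    (\<forall>(g :: 'c \<Rightarrow> 'z \<Rightarrow> 'z) z. fold (read_block k dec g) bs ([], z) = (rest, fold g xs z))"
  proof (induction bs rule: rev_induct)
    case Nil
    show ?case by (rule exI[of _ "[]"], rule exI[of _ "[]"]) (simp add: assms)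
  next
    case (snoc c bs)
    then obtain xs rest where IH: "length rest < k"
      "\<And>(g :: 'c \<Rightarrow> 'z \<Rightarrow> 'z) z. fold (read_block k dec g) bs ([], z) = (rest, fold g xs z)" by blast
    show ?case
    proof (cases "Suc (length rest) = k")
      case True
      then show ?thesis using assms
        by (intro exI[of _ "xs @ [dec (rest @ [c])]"] exI[of _ "[]"]) (simp add: IH)
    next
      case False
      then have "Suc (length rest) < k" using IH(1) by linarith
      then show ?thesis
        by (intro exI[of _ xs] exI[of _ "rest @ [c]"]) (simp add: IH)
    qed
  qed
  then show thesis using that by blast
qed

lemma fold_read_block_concat:
  assumes "0 < k" "\<And>x. x \<in> set xs \<Longrightarrow> length (enc x) = k \<and> dec (enc x) = x"
  shows "fold (read_block k dec g) (concat (map enc xs)) ([], z) = ([], fold g xs z)"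
  using assms(2)
proof (induction xs arbitrary: z)
  case Nil
  show ?case by simp
next
  case (Cons x xs)
  have part: "fold (read_block k dec g) cs (bs, z) = ([], g (dec (bs @ cs)) z)"
    if "length bs + length cs = k" "cs \<noteq> []" for bs cs z
    using that
  proof (induction cs arbitrary: bs)
    case (Cons c cs)
    then show ?case by (cases "cs = []") auto
  qed simp
  have "enc x \<noteq> []" using Cons.prems[of x] assms(1) by auto
  then show ?case using Cons.prems[of x] Cons by (simp add: part)
qed

section \<open>Counting slots and triangles\<close>

text \<open>Source of the division by 6 in the output: edges have two distinct ends, so the ordered
  triples over one triangle are its six orderings.\<close>

lemma card_ordered_triangles:
  assumes E: "E \<subseteq> vertex_pairs n"
  shows "card {(u, v, w). {u, v} \<in> E \<and> {w, u} \<in> E \<and> {w, v} \<in> E} = 6 * card (triangles E)"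
proof -
  let ?O = "{(u, v, w). {u, v} \<in> E \<and> {w, u} \<in> E \<and> {w, v} \<in> E}"
  define fib where "fib T = {(u, v, w). {u, v, w} = T}" for T :: "nat set"
  have E2: "x \<noteq> y" "x < n" "y < n" if "{x, y} \<in> E" for x y
    using that E by (auto simp: vertex_pairs_def card_insert_if split: if_splits)
  have fib: "fib {a, b, c} = {(a,b,c), (a,c,b), (b,a,c), (b,c,a), (c,a,b), (c,b,a)}"
    if "a \<noteq> b" "a \<noteq> c" "b \<noteq> c" for a b c
    unfolding fib_def
  proof (intro equalityI subsetI)
    fix q assume "q \<in> {(u, v, w). {u, v, w} = {a, b, c}}"
    then obtain u v w where q: "q = (u, v, w)" "{u, v, w} = {a, b, c}" by auto
    then have "u \<in> {a, b, c}" "v \<in> {a, b, c}" "w \<in> {a, b, c}" "a \<in> {u, v, w}" "b \<in> {u, v, w}"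
      "c \<in> {u, v, w}" by blast+
    then show "q \<in> {(a,b,c), (a,c,b), (b,a,c), (b,c,a), (c,a,b), (c,b,a)}"
      unfolding q(1) insert_iff empty_iff prod.inject using that by metis
  qed auto
  have cfib: "finite (fib T) \<and> card (fib T) = 6" if "T \<in> triangles E" for T
  proof -
    from that obtain a b c where "T = {a, b, c}" "a \<noteq> b" "b \<noteq> c" "a \<noteq> c"
      by (auto simp: triangles_def card_3_iff)
    then show ?thesis using fib[of a b c] by simp
  qed
  have pairs: "e \<in> {{u, v}, {w, u}, {w, v}}" if "e \<subseteq> {u, v, w}" "card e = 2" for e and u v w :: nat
  proof -
    obtain x y where "e = {x, y}" "x \<noteq> y" using \<open>card e = 2\<close> by (auto simp: card_2_iff)
    then have "x \<in> {u, v, w}" "y \<in> {u, v, w}" using that(1) by auto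
    then show ?thesis using \<open>e = {x, y}\<close> \<open>x \<noteq> y\<close> by (auto simp: doubleton_eq_iff)
  qed
  have O: "?O = (\<Union>T\<in>triangles E. fib T)"
  proof (intro equalityI subsetI)
    fix q assume "q \<in> ?O"
    then obtain u v w where q: "q = (u, v, w)" "{u, v} \<in> E" "{w, u} \<in> E" "{w, v} \<in> E" by auto
    have "u \<noteq> v" "w \<noteq> u" "w \<noteq> v" using q E2 by blast+
    then have "card {u, v, w} = 3" by auto
    then have "{u, v, w} \<in> triangles E" using q pairs[of _ u v w] by (auto simp: triangles_def)
    then show "q \<in> (\<Union>T\<in>triangles E. fib T)" by (auto simp: fib_def q)
  next
    fix q assume "q \<in> (\<Union>T\<in>triangles E. fib T)"
    then obtain u v w where q: "q = (u, v, w)" "{u, v, w} \<in> triangles E"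
      by (auto simp: fib_def)
    then have "card {u, v, w} = 3" and sub: "\<And>e. e \<subseteq> {u, v, w} \<Longrightarrow> card e = 2 \<Longrightarrow> e \<in> E"
      by (auto simp: triangles_def)
    then have "u \<noteq> v" "w \<noteq> u" "w \<noteq> v" by (auto simp: card_insert_if split: if_splits)
    then have "{u, v} \<in> E" "{w, u} \<in> E" "{w, v} \<in> E" by (auto intro!: sub)
    then show "q \<in> ?O" by (simp add: q)
  qed
  have fin: "finite (triangles E)"
  proof (rule finite_subset)
    show "triangles E \<subseteq> Pow {..<n}"
    proof (intro subsetI PowI)
      fix T x assume T: "T \<in> triangles E" and x: "x \<in> T"
      then obtain a b c where abc: "T = {a, b, c}" "a \<noteq> b" "b \<noteq> c" "a \<noteq> c"
        by (auto simp: triangles_def card_3_iff)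
      have "{a, b} \<in> E" "{a, c} \<in> E" using T abc by (auto simp: triangles_def)
      then show "x \<in> {..<n}" using E2[of a b] E2[of a c] x abc by auto
    qed
  qed simp
  have "card ?O = (\<Sum>T\<in>triangles E. card (fib T))"
    unfolding O by (rule card_UN_disjoint) (use fin cfib in \<open>auto simp: fib_def\<close>)
  also have "\<dots> = (\<Sum>T\<in>triangles E. 6)" using cfib by (intro sum.cong) auto
  finally show ?thesis by simp
qed

lemma card_ordered_edges_le:
  assumes "finite E" "E \<subseteq> vertex_pairs n"
  shows "finite {(x, y). {x, y} \<in> E}" "card {(x, y). {x, y} \<in> E} \<le> 2 * card E"
proof -
  let ?f = "\<lambda>e. {(x, y). {x, y} = e}"
  have f: "finite (?f e) \<and> card (?f e) \<le> 2" if e: "e \<in> E" for e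
  proof -
    have "card e = 2" using e assms(2) unfolding vertex_pairs_def by blast
    then obtain a b where ab: "e = {a, b}" unfolding card_2_iff by blast
    have sub: "?f e \<subseteq> {(a, b), (b, a)}" unfolding ab by (clarsimp simp: doubleton_eq_iff)
    have "card {(a, b), (b, a)} \<le> 2" by (cases "a = b") simp_all
    then show ?thesis
      using card_mono[OF _ sub] finite_subset[OF sub] by simp
  qed
  have eq: "{(x, y). {x, y} \<in> E} = (\<Union>e\<in>E. ?f e)" by blast
  show "finite {(x, y). {x, y} \<in> E}" unfolding eq
    by (rule finite_UN_I[OF assms(1)]) (rule conjunct1[OF f])
  have "card {(x, y). {x, y} \<in> E} \<le> (\<Sum>e\<in>E. card (?f e))"
    unfolding eq by (rule card_UN_le[OF assms(1)])
  also have "\<dots> \<le> (\<Sum>e\<in>E. 2)" by (rule sum_mono) (rule conjunct2[OF f])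
  finally show "card {(x, y). {x, y} \<in> E} \<le> 2 * card E" by simp
qed

section \<open>The slots of an honest prover\<close>

text \<open>The vertices are split into groups of size \<open>t\<close>. For every pair of groups \<open>(i, j)\<close>, the slots
  \<open>Slot i j 0 x y\<close> list the edges between the groups; then, for every vertex \<open>w\<close>, the slots
  \<open>Slot i j (Suc w) 0 u\<close> and \<open>Slot i j (Suc w) 1 v\<close> list the neighbours of \<open>w\<close> in group \<open>i\<close> and
  in group \<open>j\<close>.\<close>

definition slots :: "nat \<Rightarrow> nat \<Rightarrow> slot set" where
  "slots n t = {Slot (x div t) (y div t) 0 x y | x y. x < n \<and> y < n}
    \<union> {Slot (u div t) j (Suc w) 0 u | u j w. u < n \<and> w < n \<and> j \<le> n div t}
    \<union> {Slot i (v div t) (Suc w) 1 v | v i w. v < n \<and> w < n \<and> i \<le> n div t}"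

text \<open>Membership of a slot in the honest list depends on this single pair, which is what makes
  the list linear in the edge indicator. A slot with equal ends yields a singleton, which is never
  an edge. For \<open>w > 0\<close> the fourth component only marks the side.\<close>

fun slot_edge :: "slot \<Rightarrow> nat set" where
  "slot_edge (Slot i j 0 x y) = {x, y}"
| "slot_edge (Slot i j (Suc w) x y) = {w, y}"

definition edge_slots :: "nat \<Rightarrow> nat \<Rightarrow> nat set set \<Rightarrow> slot set" where
  "edge_slots n t E = {s \<in> slots n t. slot_edge s \<in> E}"

lemma slots_bound:
  assumes "1 \<le> t" "1 \<le> n"
  shows "slots n t \<subseteq> (\<lambda>(i, j, w, x, y). Slot i j w x y) ` ({..n} \<times> {..n} \<times> {..n} \<times> {..n} \<times> {..n})"
proof
  fix s assume s: "s \<in> slots n t"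
  have d: "x div t \<le> n" if "x < n" for x
    using that div_le_dividend[of x t] by linarith
  have g: "j \<le> n" if "j \<le> n div t" for j
    using that div_le_dividend[of n t] by linarith
  obtain i j w x y where sl: "s = Slot i j w x y" by (cases s)
  have "i \<le> n" "j \<le> n" "w \<le> n" "x \<le> n" "y \<le> n"
    using s assms unfolding sl slots_def by (auto simp: d g)
  then have "s = (\<lambda>(i, j, w, x, y). Slot i j w x y) (i, j, w, x, y)"
    "(i, j, w, x, y) \<in> {..n} \<times> {..n} \<times> {..n} \<times> {..n} \<times> {..n}"
    by (simp_all add: sl)
  then show "s \<in> (\<lambda>(i, j, w, x, y). Slot i j w x y) ` ({..n} \<times> {..n} \<times> {..n} \<times> {..n} \<times> {..n})"
    by (rule image_eqI)
qed

lemma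
  assumes "1 \<le> t" "1 \<le> n"
  shows finite_slots: "finite (slots n t)" and card_slots_le: "card (slots n t) \<le> Suc n ^ 5"
proof -
  let ?B = "{..n} \<times> {..n} \<times> {..n} \<times> {..n} \<times> {..n}"
  have c: "card ?B = Suc n ^ 5" by (simp add: card_cartesian_product power_numeral_reduce)
  show "finite (slots n t)" using slots_bound[OF assms] by (rule finite_subset) simp
  have "card (slots n t) \<le> card ?B"
    by (rule order_trans[OF card_mono[OF _ slots_bound[OF assms]] card_image_le]) simp_all
  then show "card (slots n t) \<le> Suc n ^ 5" unfolding c .
qed

text \<open>The bit matrix between two groups has \<open>t * t\<close> entries, and one vertex has
  at most \<open>t\<close> neighbours in either group. This is the dominant part of the
  memory.\<close>

lemma card_relevant_le:
  assumes "1 \<le> t"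
  shows "card {x \<in> slots n t. relevant x s} \<le> t * t + 2 * t"
proof -
  obtain i j w a b where s: "s = Slot i j w a b" by (cases s)
  define I where "I i = {i * t..<i * t + t}" for i
  have I: "x \<in> I (x div t)" for x
  proof -
    have "x mod t < t" using assms by simp
    then have "x div t * t \<le> x" "x < x div t * t + t" using div_mult_mod_eq[of x t] by linarith+
    then show ?thesis by (simp add: I_def)
  qed
  have cI: "finite (I i)" "card (I i) = t" for i by (simp_all add: I_def)
  let ?A = "(\<lambda>(x, y). Slot i j 0 x y) ` (I i \<times> I j)"
  let ?B = "Slot i j w 0 ` I i" and ?C = "Slot i j w 1 ` I j"
  have "{x \<in> slots n t. relevant x s} \<subseteq> ?A \<union> (?B \<union> ?C)"
  proof
    fix z assume "z \<in> {x \<in> slots n t. relevant x s}"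
    then consider x y where "z = Slot i j 0 x y" "i = x div t" "j = y div t"
      | u where "z = Slot i j w 0 u" "i = u div t" | v where "z = Slot i j w 1 v" "j = v div t"
      unfolding s slots_def by auto
    then show "z \<in> ?A \<union> (?B \<union> ?C)"
    proof cases
      case (1 x y)
      then have "(x, y) \<in> I i \<times> I j" using I by simp
      then show ?thesis using 1(1) by blast
    next
      case (2 u)
      then have "u \<in> I i" using I by simp
      then show ?thesis using 2(1) by blast
    next
      case (3 v)
      then have "v \<in> I j" using I by simp
      then show ?thesis using 3(1) by blast
    qed
  qed
  then have "card {x \<in> slots n t. relevant x s} \<le> card (?A \<union> (?B \<union> ?C))"
    by (intro card_mono) (simp_all add: cI)
  also have "\<dots> \<le> card ?A + (card ?B + card ?C)"
    by (meson add_left_mono card_Un_le order_trans)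
  also have "\<dots> \<le> card (I i \<times> I j) + (card (I i) + card (I j))"
    by (intro add_mono card_image_le) (simp_all add: cI)
  also have "\<dots> = t * t + 2 * t" by (simp add: cI card_cartesian_product)
  finally show ?thesis .
qed

text \<open>There are at most twice as many ordered edges as edges. Each gives one matrix slot and,
  on either of the two sides, one slot per partner group, together at most three times the number of
  partner groups.\<close>

lemma card_edge_slots_le:
  assumes "finite E" "E \<subseteq> vertex_pairs n"
  shows "card (edge_slots n t E) \<le> 6 * card E * Suc (n div t)"
proof -
  let ?O = "{(x, y). {x, y} \<in> E}" and ?G = "{..n div t}"
  let ?A = "(\<lambda>(x, y). Slot (x div t) (y div t) 0 x y) ` ?O"
  let ?B = "(\<lambda>((w, u), j). Slot (u div t) j (Suc w) 0 u) ` (?O \<times> ?G)"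
  let ?C = "(\<lambda>((w, v), i). Slot i (v div t) (Suc w) 1 v) ` (?O \<times> ?G)"
  note O = card_ordered_edges_le[OF assms]
  have "edge_slots n t E \<subseteq> ?A \<union> (?B \<union> ?C)"
  proof
    fix s assume "s \<in> edge_slots n t E"
    then consider x y where "s = Slot (x div t) (y div t) 0 x y" "{x, y} \<in> E"
      | u j w where "s = Slot (u div t) j (Suc w) 0 u" "{w, u} \<in> E" "j \<le> n div t"
      | v i w where "s = Slot i (v div t) (Suc w) 1 v" "{w, v} \<in> E" "i \<le> n div t"
      unfolding edge_slots_def slots_def by fastforce
    then show "s \<in> ?A \<union> (?B \<union> ?C)"
    proof cases
      case (1 x y)
      then show ?thesis by (intro UnI1 image_eqI[of _ _ "(x, y)"]) auto
    next
      case (2 u j w)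
      then show ?thesis by (intro UnI2 UnI1 image_eqI[of _ _ "((w, u), j)"]) auto
    next
      case (3 v i w)
      then show ?thesis by (intro UnI2 image_eqI[of _ _ "((w, v), i)"]) auto
    qed
  qed
  then have "card (edge_slots n t E) \<le> card (?A \<union> (?B \<union> ?C))"
    by (intro card_mono) (simp_all add: O)
  also have "\<dots> \<le> card ?A + (card ?B + card ?C)"
    by (meson add_left_mono card_Un_le order_trans)
  also have "\<dots> \<le> card ?O + (card (?O \<times> ?G) + card (?O \<times> ?G))"
    by (intro add_mono card_image_le) (simp_all add: O)
  also have "\<dots> = card ?O * (1 + 2 * Suc (n div t))" by (simp add: card_cartesian_product algebra_simps)
  also have "\<dots> \<le> (2 * card E) * (1 + 2 * Suc (n div t))" by (intro mult_right_mono O) simp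
  also have "\<dots> \<le> (2 * card E) * (3 * Suc (n div t))" by (intro mult_left_mono) simp_all
  finally show ?thesis by (simp add: algebra_simps)
qed

lemma in_edge_slots:
  "Slot i j 0 x y \<in> edge_slots n t E \<longleftrightarrow>
    i = x div t \<and> j = y div t \<and> x < n \<and> y < n \<and> {x, y} \<in> E"
  "Slot i j (Suc w) 0 y \<in> edge_slots n t E \<longleftrightarrow>
    i = y div t \<and> j \<le> n div t \<and> y < n \<and> w < n \<and> {w, y} \<in> E"
  "Slot i j (Suc w) 1 y \<in> edge_slots n t E \<longleftrightarrow>
    j = y div t \<and> i \<le> n div t \<and> y < n \<and> w < n \<and> {w, y} \<in> E"
  unfolding edge_slots_def slots_def by auto

text \<open>The group indices of a path are determined by \<open>u\<close> and \<open>v\<close>, so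
  each ordered triangle is counted at exactly one pair of groups.\<close>

lemma card_paths_edge_slots:
  assumes E: "E \<subseteq> vertex_pairs n"
  shows "card (paths (edge_slots n t E)) = 6 * card (triangles E)"
proof -
  let ?O = "{(u, v, w). {u, v} \<in> E \<and> {w, u} \<in> E \<and> {w, v} \<in> E}"
  let ?f = "\<lambda>(u, v, w). (u div t, v div t, w, u, v)"
  have E2: "x < n" "y < n" if "{x, y} \<in> E" for x y
    using that E by (auto simp: vertex_pairs_def)
  have "paths (edge_slots n t E) = ?f ` ?O"
  proof (intro equalityI subsetI)
    fix q assume "q \<in> paths (edge_slots n t E)"
    then obtain i j w u v where q: "q = (i, j, w, u, v)" "Slot i j 0 u v \<in> edge_slots n t E"
      "Slot i j (Suc w) 0 u \<in> edge_slots n t E" "Slot i j (Suc w) 1 v \<in> edge_slots n t E"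
      unfolding paths_def by blast
    then have "i = u div t" "j = v div t" "(u, v, w) \<in> ?O"
      unfolding in_edge_slots by simp_all
    then show "q \<in> ?f ` ?O" by (intro image_eqI[of _ _ "(u, v, w)"]) (simp_all add: q(1))
  next
    fix q assume "q \<in> ?f ` ?O"
    then obtain u v w where q: "q = (u div t, v div t, w, u, v)" "{u, v} \<in> E" "{w, u} \<in> E" "{w, v} \<in> E"
      by auto
    then have "u < n" "v < n" "w < n" using E2 by blast+
    moreover from this have "u div t \<le> n div t" "v div t \<le> n div t" by (simp_all add: div_le_mono)
    ultimately show "q \<in> paths (edge_slots n t E)"
      unfolding q(1) paths_def mem_Collect_eq case_prod_conv in_edge_slots using q by simp
  qed
  moreover have "inj_on ?f ?O" by (auto simp: inj_on_def)
  ultimately show ?thesis using card_ordered_triangles[OF E] by (simp add: card_image)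
qed

section \<open>Fingerprints and the memory of the verifier\<close>

lemma multiplicity_of_Nil [simp]: "multiplicity_of [] e = 0"
  by (simp add: multiplicity_of_def)

lemma multiplicity_of_snoc [simp]:
  "multiplicity_of (\<sigma> @ [(e', d)]) e = multiplicity_of \<sigma> e + (if e' = e then d else 0)"
  by (simp add: multiplicity_of_def)

lemma final_edges_subset:
  assumes "\<And>e d. (e, d) \<in> set \<sigma> \<Longrightarrow> e \<in> A"
  shows "final_edges \<sigma> \<subseteq> A"
proof
  fix e assume "e \<in> final_edges \<sigma>"
  then have "multiplicity_of \<sigma> e \<noteq> 0" by (simp add: final_edges_def)
  then have "\<exists>d. (e, d) \<in> set \<sigma>"
  proof (induction \<sigma> rule: rev_induct)
    case (snoc x \<sigma>)
    then show ?case by (cases x) (auto split: if_splits)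
  qed simp
  then show "e \<in> A" using assms by blast
qed

lemma finite_vertex_pairs: "finite (vertex_pairs n)"
  by (rule finite_subset[of _ "Pow {..<n}"]) (auto simp: vertex_pairs_def)

lemma strict_turnstile_streamsD:
  assumes "\<sigma> \<in> strict_turnstile_streams n m"
  shows "final_edges \<sigma> \<subseteq> vertex_pairs n" "finite (final_edges \<sigma>)" "card (final_edges \<sigma>) = m"
    "multiplicity_of \<sigma> e = of_bool (e \<in> final_edges \<sigma>)"
proof -
  have mem: "\<forall>(e, d) \<in> set \<sigma>. e \<in> vertex_pairs n"
    and nonneg: "\<forall>i \<le> length \<sigma>. \<forall>e. multiplicity_of (take i \<sigma>) e \<ge> 0"
    and le1: "\<forall>e. multiplicity_of \<sigma> e \<le> 1" and "card (final_edges \<sigma>) = m"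
    using assms unfolding strict_turnstile_streams_def by blast+
  then show "card (final_edges \<sigma>) = m" by blast
  show sub: "final_edges \<sigma> \<subseteq> vertex_pairs n" using mem by (intro final_edges_subset) auto
  then show "finite (final_edges \<sigma>)" using finite_vertex_pairs by (rule finite_subset)
  have "multiplicity_of \<sigma> e \<ge> 0" using nonneg[rule_format, of "length \<sigma>" e] by simp
  moreover have "multiplicity_of \<sigma> e \<le> 1" using le1 by blast
  ultimately show "multiplicity_of \<sigma> e = of_bool (e \<in> final_edges \<sigma>)"
    by (auto simp: final_edges_def)
qed

text \<open>Linearity of the fingerprint: a sum over slots weighted by final multiplicities can be
  accumulated update by update, without knowing any multiplicity.\<close>

lemma sum_multiplicity_of:
  assumes "finite U"
  shows "(\<Sum>s\<in>U. multiplicity_of \<sigma> (g s) * h s)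
    = (\<Sum>(e, d)\<leftarrow>\<sigma>. d * (\<Sum>s\<in>{s \<in> U. g s = e}. h s))"
proof (induction \<sigma> rule: rev_induct)
  case (snoc x \<sigma>)
  obtain e d where x: "x = (e, d)" by (cases x)
  have "(\<Sum>s\<in>U. multiplicity_of (\<sigma> @ [x]) (g s) * h s)
      = (\<Sum>s\<in>U. multiplicity_of \<sigma> (g s) * h s) + (\<Sum>s\<in>U. if g s = e then d * h s else 0)"
    unfolding x sum.distrib[symmetric] by (rule sum.cong) (auto simp: algebra_simps)
  also have "(\<Sum>s\<in>U. if g s = e then d * h s else 0) = d * (\<Sum>s\<in>{s \<in> U. g s = e}. h s)"
    using assms by (simp add: sum.inter_filter sum_distrib_left if_distrib[of "times d"] cong: if_cong)
  finally show ?case using snoc by (simp add: x)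
qed simp

lemma fold_add_mod:
  fixes p :: int
  shows "fold (\<lambda>x a. (a + f x) mod p) xs 0 = sum_list (map f xs) mod p"
proof (induction xs rule: rev_induct)
  case (snoc x xs)
  then show ?case by (simp add: mod_simps)
qed simp

lemma fold_pair: "fold (\<lambda>x (a, b). (f x a, g x b)) xs (a, b) = (fold f xs a, fold g xs b)"
  by (induction xs arbitrary: a b) simp_all

lemma card_paths_le:
  assumes "Z \<subseteq> slots n t" "1 \<le> t" "1 \<le> n"
  shows "card (paths Z) \<le> Suc n ^ 5"
proof -
  let ?B = "{..n} \<times> {..n} \<times> {..n} \<times> {..n} \<times> {..n}"
  have "paths Z \<subseteq> ?B"
  proof
    fix q assume "q \<in> paths Z"
    then obtain i j w u v where q: "q = (i, j, w, u, v)" "Slot i j 0 u v \<in> Z" "Slot i j (Suc w) 0 u \<in> Z"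
      unfolding paths_def by blast
    have "Slot i j 0 u v \<in> (\<lambda>(i, j, w, x, y). Slot i j w x y) ` ?B"
      "Slot i j (Suc w) 0 u \<in> (\<lambda>(i, j, w, x, y). Slot i j w x y) ` ?B"
      using q assms slots_bound[of t n] by blast+
    then show "q \<in> ?B" unfolding q(1) by auto
  qed
  then have "card (paths Z) \<le> card ?B" by (rule card_mono[rotated]) simp
  also have "card ?B = Suc n ^ 5" by (simp add: card_cartesian_product power_numeral_reduce)
  finally show ?thesis .
qed

section \<open>Counting the states of the verifier\<close>

lemma card_lists_length_less: "finite {bs :: bool list. length bs < k}"
  "card {bs :: bool list. length bs < k} \<le> 2 ^ k"
proof -
  have eq: "{bs :: bool list. length bs < k} = (\<Union>i<k. {bs. length bs = i})" by blast
  have fin: "finite {bs :: bool list. length bs = i}" for i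
    using finite_lists_length_eq[of "UNIV :: bool set" i] by simp
  have c: "card {bs :: bool list. length bs = i} = 2 ^ i" for i
    using card_lists_length_eq[of "UNIV :: bool set" i] by simp
  show "finite {bs :: bool list. length bs < k}" unfolding eq using fin by blast
  have "card {bs :: bool list. length bs < k} \<le> (\<Sum>i<k. card {bs :: bool list. length bs = i})"
    unfolding eq by (rule card_UN_le) simp
  also have "\<dots> = (\<Sum>i<k. 2 ^ i)" by (simp only: c)
  also have "\<dots> \<le> 2 ^ k"
    by (induction k) simp_all
  finally show "card {bs :: bool list. length bs < k} \<le> 2 ^ k" .
qed

text \<open>The retained set is not an arbitrary set of slots but part of those relevant to the last
  one; the union ranges over this last slot, and \<open>{}\<close> is the start.\<close>

definition memories :: "nat \<Rightarrow> nat \<Rightarrow> (slot set \<times> nat) option set" where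
  "memories n t = insert None (Some `
    (insert {} (\<Union>s\<in>slots n t. Pow {x \<in> slots n t. relevant x s}) \<times> {..Suc n ^ 5}))"

lemma fold_read_slot_in_memories:
  assumes "1 \<le> t" "1 \<le> n"
  shows "fold (read_slot (slots n t)) xs (Some ({}, 0)) \<in> memories n t"
proof (cases "sorted_wrt (<) xs \<and> set xs \<subseteq> slots n t")
  case True
  have "card (paths (set xs)) \<in> {..Suc n ^ 5}" using card_paths_le[OF _ assms] True by simp
  moreover have "{x \<in> set xs. relevant x (last xs)}
      \<in> insert {} (\<Union>s\<in>slots n t. Pow {x \<in> slots n t. relevant x s})"
  proof (cases "xs = []")
    case False
    then have "last xs \<in> slots n t" using True last_in_set by blast
    moreover have "{x \<in> set xs. relevant x (last xs)} \<in> Pow {x \<in> slots n t. relevant x (last xs)}"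
      using True by blast
    ultimately show ?thesis by blast
  qed simp
  ultimately show ?thesis unfolding fold_read_slot memories_def using True by simp
next
  case False
  then show ?thesis unfolding fold_read_slot memories_def by (simp only: if_False insertI1)
qed

text \<open>The exponent consists of \<open>5 * b\<close> for the last slot,
  \<open>t * t + 2 * t\<close> for the retained subset, \<open>5 * b\<close> for the counter, and
  one bit each for the empty start, the extra counter value and \<open>None\<close>.\<close>

lemma
  assumes "1 \<le> t" "1 \<le> n" "n < 2 ^ b"
  shows finite_memories: "finite (memories n t)"
    and card_memories_le: "card (memories n t) \<le> 2 ^ (10 * b + t * t + 2 * t + 3)"
proof -
  let ?U = "slots n t"
  let ?P = "\<lambda>s. Pow {x \<in> ?U. relevant x s}"
  let ?M = "insert {} (\<Union>s\<in>?U. ?P s)"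
  let ?W = "t * t + 2 * t"
  note fin = finite_slots[OF assms(1,2)]
  have finM: "finite ?M" using fin by simp
  show "finite (memories n t)" unfolding memories_def using finM by simp
  have nb: "Suc n ^ 5 \<le> 2 ^ (5 * b)"
  proof -
    have "Suc n ^ 5 \<le> (2 ^ b) ^ 5" by (rule power_mono) (use assms in auto)
    then show ?thesis by (simp add: power_mult[symmetric] mult.commute)
  qed
  have "card (?P s) \<le> 2 ^ ?W" for s
    using card_relevant_le[OF assms(1), of n s] fin
    by (simp add: card_Pow power_increasing)
  then have "(\<Sum>s\<in>?U. card (?P s)) \<le> (\<Sum>s\<in>?U. 2 ^ ?W)" by (intro sum_mono) blast
  then have "card (\<Union>s\<in>?U. ?P s) \<le> card ?U * 2 ^ ?W"
    using card_UN_le[OF fin, of ?P] by simp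
  also have "\<dots> \<le> 2 ^ (5 * b) * 2 ^ ?W"
    using card_slots_le[OF assms(1,2)] nb by (intro mult_right_mono) auto
  finally have "card (\<Union>s\<in>?U. ?P s) \<le> 2 ^ (5 * b + ?W)" by (simp add: power_add)
  moreover have "card ?M \<le> Suc (card (\<Union>s\<in>?U. ?P s))"
    by (rule card_insert_le_m1) simp_all
  moreover have "(1::nat) \<le> 2 ^ (5 * b + ?W)" by simp
  ultimately have M: "card ?M \<le> 2 ^ Suc (5 * b + ?W)" unfolding power_Suc by linarith
  have "card {..Suc n ^ 5} \<le> 2 ^ Suc (5 * b)"
  proof -
    have "(1::nat) \<le> 2 ^ (5 * b)" by simp
    then show ?thesis using nb unfolding power_Suc card_atMost by linarith
  qed
  then have "card ?M * card {..Suc n ^ 5} \<le> 2 ^ Suc (5 * b + ?W) * 2 ^ Suc (5 * b)"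
    using M by (intro mult_mono) auto
  also have "\<dots> = 2 ^ (10 * b + ?W + 2)" unfolding power_add[symmetric] by simp
  finally have "card (?M \<times> {..Suc n ^ 5}) \<le> 2 ^ (10 * b + ?W + 2)"
    by (simp only: card_cartesian_product)
  moreover have "card (memories n t) \<le> Suc (card (?M \<times> {..Suc n ^ 5}))"
  proof -
    have "card (memories n t) \<le> Suc (card (Some ` (?M \<times> {..Suc n ^ 5})))"
      unfolding memories_def by (rule card_insert_le_m1) simp_all
    then show ?thesis by (simp only: card_image inj_Some)
  qed
  moreover have "(1::nat) \<le> 2 ^ (10 * b + ?W + 2)" by simp
  ultimately have "card (memories n t) \<le> 2 ^ Suc (10 * b + ?W + 2)" unfolding power_Suc by linarith
  moreover have "Suc (10 * b + ?W + 2) = 10 * b + t * t + 2 * t + 3" by simp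
  ultimately show "card (memories n t) \<le> 2 ^ (10 * b + t * t + 2 * t + 3)" by (simp only:)
qed

text \<open>Two different subsets of \<open>U\<close> have equal fingerprints only at the roots of a nonzero polynomial.\<close>

lemma card_fingerprint_collisions_le:
  fixes idx :: "'s \<Rightarrow> nat"
  assumes "prime p" "finite U" "inj_on idx U" "\<And>s. s \<in> U \<Longrightarrow> idx s < L"
    and "A \<subseteq> U" "B \<subseteq> U" "A \<noteq> B"
  shows "card {r\<in>{..<p}. (\<Sum>s\<in>A. int r ^ idx s) mod int p = (\<Sum>s\<in>B. int r ^ idx s) mod int p} \<le> L"
proof -
  \<comment> \<open>A nonzero difference of two indicators is 1 or -1, hence not divisible by
    \<open>p\<close>. For lists with repetitions it could be a multiple of \<open>p\<close>.\<close>
  define z :: "'s \<Rightarrow> int" where "z s = of_bool (s \<in> A) - of_bool (s \<in> B)" for s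
  define f where "f = (\<Sum>s\<in>U. monom (z s) (idx s))"
  have coeff: "coeff f (idx s) = z s" if "s \<in> U" for s
  proof -
    have "coeff f (idx s) = (\<Sum>s'\<in>U. if s' = s then z s' else 0)"
      unfolding f_def coeff_sum using that assms(3)
      by (intro sum.cong) (auto simp: inj_on_def)
    then show ?thesis using that assms(2) by simp
  qed
  obtain s where s: "s \<in> U" "(s \<in> A) \<noteq> (s \<in> B)" using assms(5-7) by blast
  then have "\<bar>z s\<bar> = 1" by (auto simp: z_def)
  then have "\<not> int p dvd z s"
    using prime_gt_1_nat[OF assms(1)] by (metis abs_dvd_iff dvd_abs_iff int_dvd_int_iff nat_dvd_1_iff_1 of_nat_1 less_irrefl)
  then have "\<exists>i. \<not> int p dvd coeff f i" using coeff[OF s(1)] by metis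
  then have "card {r\<in>{..<p}. int p dvd poly f (int r)} \<le> degree f"
    by (rule card_roots_mod_prime_le[OF assms(1)])
  moreover have "degree f \<le> L"
    unfolding f_def
  proof (rule degree_sum_le[OF assms(2)])
    fix s assume "s \<in> U"
    then show "degree (monom (z s) (idx s)) \<le> L"
      using assms(4)[of s] degree_monom_le[of "z s" "idx s"] by simp
  qed
  moreover have "poly f (int r) = (\<Sum>s\<in>A. int r ^ idx s) - (\<Sum>s\<in>B. int r ^ idx s)" for r
  proof -
    have sub: "(\<Sum>s\<in>U. of_bool (s \<in> C) * int r ^ idx s) = (\<Sum>s\<in>C. int r ^ idx s)" if "C \<subseteq> U" for C
    proof -
      have "(\<Sum>s\<in>U. of_bool (s \<in> C) * int r ^ idx s) = (\<Sum>s\<in>U. if s \<in> C then int r ^ idx s else 0)"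
        by (rule sum.cong) auto
      also have "\<dots> = (\<Sum>s\<in>U \<inter> C. int r ^ idx s)" using assms(2) by (simp add: sum.inter_restrict)
      finally show ?thesis using that by (simp add: Int_absorb1)
    qed
    have "poly f (int r) = (\<Sum>s\<in>U. of_bool (s \<in> A) * int r ^ idx s - of_bool (s \<in> B) * int r ^ idx s)"
      unfolding f_def poly_sum by (rule sum.cong) (simp_all add: poly_monom z_def algebra_simps)
    then show ?thesis using sub[OF assms(5)] sub[OF assms(6)] by (simp add: sum_subtractf)
  qed
  ultimately show ?thesis by (simp add: mod_eq_dvd_iff)
qed

section \<open>The scheme\<close>

text \<open>The modulus is at least three times the number of slots, so a wrong list survives for at
  most a third of the points. The memory holds the point and two fingerprints
  (\<open>3 * q\<close>), an incomplete block (\<open>5 * b\<close>) and the state of the slot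
  reader.\<close>

lemma triangle_scheme:
  fixes n m t b p q :: nat and a v :: real
  assumes n: "2 \<le> n" "n < 2 ^ b" and m: "1 \<le> m" and t: "1 \<le> t"
    and p: "prime p" "3 * Suc n ^ 5 \<le> p" "p \<le> 2 ^ q"
    and a: "real (6 * m * Suc (n div t) * (5 * b)) \<le> a"
    and v: "real (3 * q + 15 * b + t * t + 2 * t + 3) \<le> v"
  shows "\<exists>P V. online_scheme (strict_turnstile_streams n m) triangle_count a v P V"
proof -
  define U where "U = slots n t"
  define k where "k = 5 * b"
  have b: "1 \<le> b" using n by (cases b) auto
  then have k: "0 < k" by (simp add: k_def)
  have finU: "finite U" unfolding U_def using finite_slots t n by simp
  have cU: "card U \<le> Suc n ^ 5" unfolding U_def using card_slots_le t n by simp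
  have nb: "Suc n ^ 5 \<le> 2 ^ k"
  proof -
    have "Suc n ^ 5 \<le> (2 ^ b) ^ 5" by (rule power_mono) (use n in auto)
    then show ?thesis by (simp add: k_def power_mult[symmetric] mult.commute)
  qed
  have fB: "finite {bs :: bool list. length bs = k}"
    using finite_lists_length_eq[of "UNIV :: bool set" k] by simp
  have cB: "card {bs :: bool list. length bs = k} = 2 ^ k"
    using card_lists_length_eq[of "UNIV :: bool set" k] by simp
  obtain enc :: "slot \<Rightarrow> bool list" where enc: "enc ` U \<subseteq> {bs. length bs = k}" "inj_on enc U"
    using card_le_inj[OF finU fB] cU nb cB by auto
  \<comment> \<open>A block that encodes no slot decodes to something unspecified; soundness covers
    every list of decoded slots, so this gives the prover no advantage.\<close>
  define dec where "dec = the_inv_into U enc"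
  have dec: "length (enc s) = k \<and> dec (enc s) = s" if "s \<in> U" for s
    using that enc by (auto simp: dec_def the_inv_into_f_f)
  obtain idx :: "slot \<Rightarrow> nat" where idx: "bij_betw idx U {0..<card U}"
    using ex_bij_betw_finite_nat[OF finU] by blast
  have idx_less: "idx s < card U" if "s \<in> U" for s
    using idx that by (auto simp: bij_betw_def)
  define h where "h r s = int r ^ idx s" for r s
  define read_elem :: "nat \<Rightarrow> graph_update \<Rightarrow> int \<Rightarrow> int" where
    "read_elem r = (\<lambda>(e, d) x. (x + d * (\<Sum>s\<in>{s \<in> U. slot_edge s = e}. h r s)) mod int p)" for r
  define add_print where "add_print r s f = (f + h r s) mod int p" for r s f
  define read_bit where
    "read_bit r = read_block k dec (\<lambda>s (A, f). (read_slot U s A, add_print r s f))" for r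
  define result :: "nat \<Rightarrow> int \<Rightarrow> bool list \<times> (slot set \<times> nat) option \<times> int \<Rightarrow> nat option" where
    "result r x = (\<lambda>(bs, A, f). case A of None \<Rightarrow> None
      | Some (_, c) \<Rightarrow> if bs = [] \<and> x = f then Some (c div 6) else None)" for r x
  define y0 :: "bool list \<times> (slot set \<times> nat) option \<times> int" where "y0 = ([], Some ({}, 0), 0)"
  define honest where
    "honest \<sigma> = concat (map enc (sorted_list_of_set (edge_slots n t (final_edges \<sigma>))))" for \<sigma>
  have p0: "0 < p" using p(1) by (rule prime_gt_0_nat)
  have print: "fold (add_print r) xs 0 = (\<Sum>s\<leftarrow>xs. h r s) mod int p" for r xs
    unfolding add_print_def by (rule fold_add_mod)
  have sketch: "fold (read_elem r) \<sigma> 0 = (\<Sum>s\<in>edge_slots n t (final_edges \<sigma>). h r s) mod int p"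
    if "\<sigma> \<in> strict_turnstile_streams n m" for r \<sigma>
  proof -
    let ?H = "\<lambda>(e, d). d * (\<Sum>s\<in>{s \<in> U. slot_edge s = e}. h r s)"
    have "read_elem r = (\<lambda>x y. (y + ?H x) mod int p)"
      by (auto simp: read_elem_def fun_eq_iff)
    then have "fold (read_elem r) \<sigma> 0 = (\<Sum>x\<leftarrow>\<sigma>. ?H x) mod int p"
      by (simp only: fold_add_mod)
    also have "(\<Sum>x\<leftarrow>\<sigma>. ?H x) = (\<Sum>s\<in>U. multiplicity_of \<sigma> (slot_edge s) * h r s)"
      by (rule sum_multiplicity_of[OF finU, symmetric])
    also have "\<dots> = (\<Sum>s\<in>U. if slot_edge s \<in> final_edges \<sigma> then h r s else 0)"
      by (rule sum.cong) (simp_all add: strict_turnstile_streamsD(4)[OF that])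
    also have "\<dots> = (\<Sum>s\<in>edge_slots n t (final_edges \<sigma>). h r s)"
      unfolding edge_slots_def U_def[symmetric] by (rule sum.inter_filter[OF finU, symmetric])
    finally show ?thesis .
  qed
  have elem_in: "fold (read_elem r) \<sigma> 0 \<in> {0..<int p}" for r \<sigma>
    by (cases \<sigma> rule: rev_cases) (use p0 in \<open>auto simp: read_elem_def split: prod.split\<close>)
  have print_in: "fold (add_print r) xs 0 \<in> {0..<int p}" for r xs
    unfolding print using p0 by simp
  \<comment> \<open>The list \<open>xs\<close> is fixed before \<open>r\<close>: the prover commits
    to a set without knowing the evaluation point.\<close>
  have bits: "\<exists>rest xs. length rest < k \<and>
    (\<forall>r. fold (read_bit r) bs y0 =
      (rest, fold (read_slot U) xs (Some ({}, 0)), fold (add_print r) xs 0))" for bs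
  proof -
    obtain xs rest where "length rest < k"
      "\<And>(g :: slot \<Rightarrow> (slot set \<times> nat) option \<times> int \<Rightarrow> (slot set \<times> nat) option \<times> int) z.
        fold (read_block k dec g) bs ([], z) = (rest, fold g xs z)"
      by (rule fold_read_block[OF k, where dec = dec and bs = bs]) (rule that)
    then show ?thesis unfolding read_bit_def y0_def
      by (intro exI[of _ rest] exI[of _ xs]) (simp add: fold_pair)
  qed
  have honest_bits: "fold (read_bit r) (honest \<sigma>) y0 = ([],
      fold (read_slot U) (sorted_list_of_set (edge_slots n t (final_edges \<sigma>))) (Some ({}, 0)),
      fold (add_print r) (sorted_list_of_set (edge_slots n t (final_edges \<sigma>))) 0)" for r \<sigma>
  proof -
    have sub: "edge_slots n t (final_edges \<sigma>) \<subseteq> U" by (auto simp: edge_slots_def U_def)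
    have "length (enc s) = k \<and> dec (enc s) = s"
      if "s \<in> set (sorted_list_of_set (edge_slots n t (final_edges \<sigma>)))" for s
      using that dec sub finite_subset[OF sub finU] by auto
    then show ?thesis
      unfolding read_bit_def y0_def honest_def by (subst fold_read_block_concat[OF k]) (simp_all add: fold_pair)
  qed
  have run_slots: "fold (read_slot U) xs (Some ({}, 0)) =
    Some ({x \<in> set xs. relevant x (last xs)}, 6 * triangle_count \<sigma>)"
    if "\<sigma> \<in> strict_turnstile_streams n m" "sorted_wrt (<) xs" "set xs = edge_slots n t (final_edges \<sigma>)"
    for xs \<sigma>
  proof -
    have "set xs \<subseteq> U" using that(3) by (auto simp: edge_slots_def U_def)
    moreover have "card (paths (set xs)) = 6 * triangle_count \<sigma>"
      unfolding that(3) triangle_count_def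
      by (rule card_paths_edge_slots[OF strict_turnstile_streamsD(1)[OF that(1)]])
    ultimately show ?thesis unfolding fold_read_slot using that(2) by simp
  qed
  have print_set: "fold (add_print r) xs 0 = (\<Sum>s\<in>set xs. h r s) mod int p"
    if "sorted_wrt (<) xs" for xs r
    using that by (simp add: print sum_list_distinct_conv_sum_set strict_sorted_iff)
  show ?thesis
  proof (rule online_scheme_of_tracks[where R = "{..<p}" and Sx = "{0..<int p}" and xinit = 0
        and Sy = "{bs. length bs < k} \<times> memories n t \<times> {0..<int p}" and yinit = y0
        and read_elem = read_elem and read_bit = read_bit and result = result and honest = honest
        and M = "3 * q + 15 * b + t * t + 2 * t + 3"])
    show "{..<p} \<noteq> {}" using p0 by auto
    show "finite ({bs :: bool list. length bs < k} \<times> memories n t \<times> {0..<int p})"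
      using card_lists_length_less finite_memories[of t n b] t n by simp
    show "fold (read_elem r) \<sigma> 0 \<in> {0..<int p}" for r \<sigma> by (rule elem_in)
    show "fold (read_bit r) bs y0 \<in> {bs. length bs < k} \<times> memories n t \<times> {0..<int p}" for r bs
    proof -
      obtain rest xs where "length rest < k" "fold (read_bit r) bs y0 =
        (rest, fold (read_slot U) xs (Some ({}, 0)), fold (add_print r) xs 0)"
        using bits by blast
      moreover have "fold (read_slot U) xs (Some ({}, 0)) \<in> memories n t"
        unfolding U_def by (rule fold_read_slot_in_memories) (use t n in auto)
      ultimately show ?thesis using print_in by auto
    qed
    have "card ({bs :: bool list. length bs < k} \<times> memories n t \<times> {0..<int p})
        \<le> 2 ^ k * (2 ^ (10 * b + t * t + 2 * t + 3) * 2 ^ q)"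
      unfolding card_cartesian_product
      by (intro mult_mono card_lists_length_less card_memories_le) (use p t n in auto)
    then have "card {..<p} * card {0..<int p}
        * card ({bs :: bool list. length bs < k} \<times> memories n t \<times> {0..<int p})
        \<le> 2 ^ q * 2 ^ q * (2 ^ k * (2 ^ (10 * b + t * t + 2 * t + 3) * 2 ^ q))"
      using p(3) by (intro mult_mono) auto
    also have "\<dots> = 2 ^ (3 * q + 15 * b + t * t + 2 * t + 3)"
      unfolding power_add[symmetric] k_def by (rule arg_cong[where f = "(^) 2"]) simp
    finally show "card {..<p} * card {0..<int p}
        * card ({bs :: bool list. length bs < k} \<times> memories n t \<times> {0..<int p})
        \<le> 2 ^ (3 * q + 15 * b + t * t + 2 * t + 3)" .
    show "[] \<notin> strict_turnstile_streams n m"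
    proof
      assume "[] \<in> strict_turnstile_streams n m"
      from strict_turnstile_streamsD(3)[OF this] m show False by (simp add: final_edges_def)
    qed
  next
    fix \<sigma> assume \<sigma>: "\<sigma> \<in> strict_turnstile_streams n m"
    let ?Z = "edge_slots n t (final_edges \<sigma>)"
    have sub: "?Z \<subseteq> U" by (auto simp: edge_slots_def U_def)
    have finZ: "finite ?Z" using finite_subset[OF sub finU] .
    have lenc: "length (enc s) = k" if "s \<in> set (sorted_list_of_set ?Z)" for s
      using that dec sub finZ by auto
    have "length (honest \<sigma>) = (\<Sum>s\<leftarrow>sorted_list_of_set ?Z. k)"
      unfolding honest_def length_concat map_map o_def
      by (rule arg_cong[where f = sum_list], rule map_cong[OF refl lenc])
    also have "\<dots> = card ?Z * k" by (simp add: sum_list_triv)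
    also have "\<dots> \<le> 6 * m * Suc (n div t) * k"
      using card_edge_slots_le[OF strict_turnstile_streamsD(2,1)[OF \<sigma>], of t]
        strict_turnstile_streamsD(3)[OF \<sigma>] by (intro mult_right_mono) auto
    finally show "real (length (honest \<sigma>)) \<le> a"
      using a unfolding k_def by (meson of_nat_mono order_trans)
    have sorted: "sorted_wrt (<) (sorted_list_of_set ?Z)" by simp
    have setZ: "set (sorted_list_of_set ?Z) = ?Z" using finZ by simp
    show "result r (fold (read_elem r) \<sigma> 0) (fold (read_bit r) (honest \<sigma>) y0) = Some (triangle_count \<sigma>)" for r
      unfolding honest_bits run_slots[OF \<sigma> sorted setZ] print_set[OF sorted] sketch[OF \<sigma>] setZ
      by (simp add: result_def)
    fix bs
    let ?Bad = "{r \<in> {..<p}. result r (fold (read_elem r) \<sigma> 0) (fold (read_bit r) bs y0)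
      \<notin> {Some (triangle_count \<sigma>), None}}"
    obtain rest xs where xs: "\<And>r. fold (read_bit r) bs y0 =
        (rest, fold (read_slot U) xs (Some ({}, 0)), fold (add_print r) xs 0)"
      using bits[of bs] by blast
    \<comment> \<open>Only an increasing list of slots with the wrong set can deceive, and only at a
      collision. An ill-formed list is rejected; the right set leads to the right count or to
      rejection.\<close>
    show "3 * card ?Bad \<le> card {..<p}"
    proof (cases "sorted_wrt (<) xs \<and> set xs \<subseteq> U \<and> set xs \<noteq> ?Z")
      case True
      have "?Bad \<subseteq> {r \<in> {..<p}. (\<Sum>s\<in>set xs. int r ^ idx s) mod int p = (\<Sum>s\<in>?Z. int r ^ idx s) mod int p}"
      proof
        fix r assume r: "r \<in> ?Bad"
        have "result r x (fold (read_bit r) bs y0) = None" if "x \<noteq> fold (add_print r) xs 0" for x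
          unfolding xs result_def using that by (simp split: option.splits prod.splits)
        then have "fold (read_elem r) \<sigma> 0 = fold (add_print r) xs 0" using r by blast
        then show "r \<in> {r \<in> {..<p}. (\<Sum>s\<in>set xs. int r ^ idx s) mod int p = (\<Sum>s\<in>?Z. int r ^ idx s) mod int p}"
          using r True unfolding sketch[OF \<sigma>] by (simp add: print_set h_def)
      qed
      then have "card ?Bad \<le> card \<dots>" by (intro card_mono) auto
      also have "\<dots> \<le> card U"
        by (rule card_fingerprint_collisions_le[OF p(1) finU])
          (use True sub idx_less in \<open>auto simp: bij_betw_imp_inj_on[OF idx]\<close>)
      finally show ?thesis using cU p(2) by simp
    next
      case False
      have "?Bad = {}"
      proof (cases "sorted_wrt (<) xs \<and> set xs \<subseteq> U")
        case True
        with False have "set xs = ?Z" by blast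
        then have run: "fold (read_slot U) xs (Some ({}, 0)) =
            Some ({x \<in> set xs. relevant x (last xs)}, 6 * triangle_count \<sigma>)"
          using True by (intro run_slots[OF \<sigma>]) auto
        show ?thesis unfolding xs run result_def by simp
      next
        case False
        then have run: "fold (read_slot U) xs (Some ({}, 0)) = None"
          unfolding fold_read_slot by (simp only: if_False)
        show ?thesis unfolding xs run result_def by simp
      qed
      then show ?thesis by (simp only: card.empty)
    qed
  qed (use v in auto)
qed

text \<open>Covers the parameters for which a logarithm in the bounds is 0: there is at most one
  edge, hence no triangle, and the answer 0 costs nothing.\<close>

lemma zero_scheme:
  assumes "1 \<le> m" "n = 1 \<or> m = 1"
  shows "\<exists>P V. online_scheme (strict_turnstile_streams n m) triangle_count 0 0 P V"
proof (rule online_scheme_of_tracks[where R = "{()}" and Sx = "{()}" and Sy = "{()}" and xinit = "()"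
      and yinit = "()" and read_elem = "\<lambda>_ _ _. ()" and read_bit = "\<lambda>_ _ _. ()" and M = 0
      and result = "\<lambda>_ _ _. Some 0" and honest = "\<lambda>_. []"])
  show "[] \<notin> strict_turnstile_streams n m"
  proof
    assume "[] \<in> strict_turnstile_streams n m"
    from strict_turnstile_streamsD(3)[OF this] assms(1) show False by (simp add: final_edges_def)
  qed
  have zero: "triangle_count \<sigma> = 0" if \<sigma>: "\<sigma> \<in> strict_turnstile_streams n m" for \<sigma>
  proof -
    let ?E = "final_edges \<sigma>"
    note E = strict_turnstile_streamsD(1-3)[OF \<sigma>]
    have one: "card ?E \<le> 1"
    proof (cases "m = 1")
      case False
      then have "n = 1" using assms(2) by blast
      have "vertex_pairs n = {}"
      proof -
        have "card e \<noteq> 2" if "e \<subseteq> {..<n}" for e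
          using card_mono[OF _ that] \<open>n = 1\<close> by simp
        then show ?thesis unfolding vertex_pairs_def by blast
      qed
      then show ?thesis using E(1) by simp
    qed (use E(3) in simp)
    have "triangles ?E = {}"
    proof (rule ccontr)
      assume "triangles ?E \<noteq> {}"
      then obtain T where T: "card T = 3" "\<And>e. e \<subseteq> T \<Longrightarrow> card e = 2 \<Longrightarrow> e \<in> ?E"
        by (auto simp: triangles_def)
      then obtain x y z where xyz: "T = {x, y, z}" "x \<noteq> y" "y \<noteq> z" "x \<noteq> z"
        by (auto simp: card_3_iff)
      then have "{x, y} \<in> ?E" "{x, z} \<in> ?E" by (simp_all add: T(2))
      then have "{{x, y}, {x, z}} \<subseteq> ?E" by blast
      then have "card {{x, y}, {x, z}} \<le> card ?E" using E(2) by (intro card_mono)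
      moreover have "{x, y} \<noteq> {x, z}" using xyz(2-4) by (metis doubleton_eq_iff)
      then have "card {{x, y}, {x, z}} = 2" unfolding card_2_iff by blast
      ultimately show False using one by linarith
    qed
    then show ?thesis by (simp add: triangle_count_def)
  qed
  show "Some 0 = Some (triangle_count \<sigma>)" if "\<sigma> \<in> strict_turnstile_streams n m" for \<sigma>
    using zero[OF that] by simp
  show "3 * card {r \<in> {()}. Some 0 \<notin> {Some (triangle_count \<sigma>), None}} \<le> card {()}"
    if "\<sigma> \<in> strict_turnstile_streams n m" for \<sigma>
    using zero[OF that] by simp
qed auto

lemma card_vertex_pairs_le: "card (vertex_pairs n) \<le> n ^ 2"
proof -
  have "vertex_pairs n \<subseteq> (\<lambda>(x, y). {x, y}) ` ({..<n} \<times> {..<n})"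
  proof
    fix e assume "e \<in> vertex_pairs n"
    then obtain x y where "e = {x, y}" "x < n" "y < n"
      by (auto simp: vertex_pairs_def card_2_iff)
    then show "e \<in> (\<lambda>(x, y). {x, y}) ` ({..<n} \<times> {..<n})"
      by (intro image_eqI[of _ _ "(x, y)"]) auto
  qed
  then have "card (vertex_pairs n) \<le> card ({..<n} \<times> {..<n})"
    by (intro order_trans[OF card_mono card_image_le]) auto
  then show ?thesis by (simp add: card_cartesian_product power2_eq_square)
qed

text \<open>Multiplicities are unbounded along the stream, but at the end they are 0 or 1, so that their
  parities determine the graph.\<close>

lemma parity_scheme:
  assumes "1 \<le> m" "0 \<le> a" "real (n ^ 2) \<le> v"
  shows "\<exists>P V. online_scheme (strict_turnstile_streams n m) triangle_count a v P V"
proof -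
  define flip :: "unit \<Rightarrow> graph_update \<Rightarrow> nat set set \<Rightarrow> nat set set" where
    "flip = (\<lambda>_ (e, d) A. if e \<in> vertex_pairs n \<and> odd d then (A - {e}) \<union> ({e} - A) else A)"
  have flip: "fold (flip u) \<sigma> {} = {e \<in> vertex_pairs n. odd (multiplicity_of \<sigma> e)}" for \<sigma> u
  proof (induction \<sigma> rule: rev_induct)
    case (snoc x \<sigma>)
    then show ?case by (cases x) (auto simp: flip_def)
  qed simp
  have final: "fold (flip u) \<sigma> {} = final_edges \<sigma>" if "\<sigma> \<in> strict_turnstile_streams n m" for \<sigma> u
    using strict_turnstile_streamsD(1)[OF that]
    by (auto simp: flip strict_turnstile_streamsD(4)[OF that])
  show ?thesis
  proof (rule online_scheme_of_tracks[where R = "{()}" and Sx = "Pow (vertex_pairs n)" and Sy = "{()}"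
        and xinit = "{}" and yinit = "()" and read_elem = flip and read_bit = "\<lambda>_ _ _. ()" and M = "n ^ 2"
        and result = "\<lambda>_ E _. Some (card (triangles E))" and honest = "\<lambda>_. []"])
    show "[] \<notin> strict_turnstile_streams n m"
      using assms(1) strict_turnstile_streamsD(3)[of "[]" n m] by (auto simp: final_edges_def)
    show "card {()} * card (Pow (vertex_pairs n)) * card {()} \<le> 2 ^ n ^ 2"
      using card_vertex_pairs_le[of n] finite_vertex_pairs by (simp add: card_Pow)
    show "fold (flip u) \<sigma> {} \<in> Pow (vertex_pairs n)" for u \<sigma> unfolding flip by auto
  qed (use assms finite_vertex_pairs final in \<open>auto simp: triangle_count_def\<close>)
qed

section \<open>Choice of the parameters\<close>

theorem theorem6p2:
  shows "\<exists>K::real. \<forall>(n::nat) (m::nat) (c\<^sub>v::real). n \<ge> 1 \<and> m \<ge> 1 \<and> c\<^sub>v > 1 \<longrightarrow>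
    (let c\<^sub>a = real m * real n * c\<^sub>v powr (- 1 / 2) in
      \<exists>P V. online_scheme (strict_turnstile_streams n m) triangle_count
        (K * (c\<^sub>a * log 2 (real n) * log 2 (real m)))
        (K * (c\<^sub>v * log 2 (real n) * log 2 (real m))) P V)"
proof (intro exI[of _ 240] allI impI, unfold Let_def, elim conjE)
  fix n m :: nat and c :: real
  assume nm: "1 \<le> n" "1 \<le> m" and c: "1 < c"
  let ?ln = "log 2 (real n)" and ?lm = "log 2 (real m)"
  \<comment> \<open>The constant is 6 * 5 * 4 * 2: 6 from counting slots, 5 from
    \<open>5 * b\<close> bits per slot, 4 from rounding the group size and the number of groups, 2
    from rounding the logarithm. The memory bound needs only 144 + 3.\<close>
  let ?a = "240 * (real m * real n * c powr (- 1 / 2) * ?ln * ?lm)"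
  let ?v = "240 * (c * ?ln * ?lm)"
  show "\<exists>P V. online_scheme (strict_turnstile_streams n m) triangle_count ?a ?v P V"
  proof (cases "n = 1 \<or> m = 1")
    case True
    then have "?a = 0" "?v = 0" by auto
    then show ?thesis using zero_scheme[OF nm(2) True] by (simp only:)
  next
    case False
    then have nm2: "2 \<le> n" "2 \<le> m" using nm by auto
    then have ln: "1 \<le> ?ln" and lm: "1 \<le> ?lm" by (simp_all add: le_log_iff)
    show ?thesis
    proof (cases "real (n ^ 2) \<le> c")
      case True
      have "c * (1 * 1) \<le> c * (?ln * ?lm)" using c ln lm by (intro mult_left_mono mult_mono) auto
      then have "real (n ^ 2) \<le> c * (?ln * ?lm)" "0 \<le> c * (?ln * ?lm)" using True c by linarith+
      then have "real (n ^ 2) \<le> 240 * (c * (?ln * ?lm))" by linarith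
      then have "real (n ^ 2) \<le> ?v" by (simp only: mult.assoc)
      moreover have "0 \<le> ?a" using ln lm by simp
      ultimately show ?thesis using nm(2) by (intro parity_scheme)
    next
      case False
      define t where "t = nat \<lfloor>sqrt c\<rfloor>"
      have sc: "1 < sqrt c" using c by simp
      have t1: "1 \<le> t" using sc by (simp add: t_def le_nat_iff le_floor_iff)
      have t_le: "real t \<le> sqrt c" using sc by (simp add: t_def)
      have "sqrt c < real t + 1" using sc by (simp add: t_def)
      then have t_ge: "sqrt c \<le> 2 * real t" using t1 by linarith
      have tt: "real (t * t) \<le> c"
        using mult_mono[OF t_le t_le] sc c by simp
      have "sqrt c < real n"
      proof -
        have "sqrt c < sqrt ((real n)\<^sup>2)" using False by (intro real_sqrt_less_mono) simp
        then show ?thesis by simp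
      qed
      then have tn: "t \<le> n" using t_le by linarith
      define b where "b = Suc (nat \<lfloor>?ln\<rfloor>)"
      have nb: "n < 2 ^ b"
      proof -
        have "?ln < real b" using ln by (simp add: b_def) linarith
        then have "real n < 2 powr real b" using nm2 by (simp add: log_less_iff)
        then have "real n < real (2 ^ b)" by (simp add: powr_realpow)
        then show ?thesis by (simp only: of_nat_less_iff)
      qed
      have b_le: "real b \<le> 2 * ?ln" and b1: "1 \<le> b"
        using ln by (simp_all add: b_def) linarith
      obtain p where p: "prime p" "3 * Suc n ^ 5 \<le> p" "p \<le> 16 * (3 * Suc n ^ 5)\<^sup>2"
        by (rule prime_between[of "3 * Suc n ^ 5"]) auto
      \<comment> \<open>The square of \<open>3 * Suc n ^ 5\<close> and the factor 16 give 144, which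
        is below \<open>2 ^ 8\<close>.\<close>
      have "p \<le> 2 ^ (10 * b + 8)"
      proof -
        have "Suc n ^ 10 \<le> (2 ^ b) ^ 10" by (rule power_mono) (use nb in auto)
        moreover have "16 * (3 * Suc n ^ 5)\<^sup>2 = 144 * Suc n ^ 10"
          by (simp add: power_mult_distrib flip: power_mult)
        moreover have "(2::nat) ^ (10 * b + 8) = 256 * (2 ^ b) ^ 10"
          by (simp add: power_add mult.commute flip: power_mult)
        ultimately show ?thesis using p(3) by linarith
      qed
      moreover have "real (6 * m * Suc (n div t) * (5 * b)) \<le> ?a"
      proof -
        \<comment> \<open>Here \<open>c < n\<^sup>2\<close> is used through
          \<open>t \<le> n\<close>: for larger groups the rounded-up number of groups would exceed
          the order of \<open>n / sqrt c\<close>.\<close>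
        have "t * Suc (n div t) \<le> 2 * n" using tn times_div_less_eq_dividend[of t n]
          unfolding mult_Suc_right by linarith
        then have "real (t * Suc (n div t)) \<le> real (2 * n)" by (simp only: of_nat_le_iff)
        then have "real t * real (Suc (n div t)) \<le> 2 * real n"
          by (simp only: of_nat_mult of_nat_numeral)
        then have "2 * real t * real (Suc (n div t)) \<le> 4 * real n" by (simp only: mult.assoc)
        moreover have "sqrt c * real (Suc (n div t)) \<le> 2 * real t * real (Suc (n div t))"
          by (rule mult_right_mono[OF t_ge]) simp
        ultimately have "sqrt c * real (Suc (n div t)) \<le> 4 * real n" by linarith
        then have G: "real (Suc (n div t)) \<le> 4 * real n / sqrt c"
          using sc by (subst pos_le_divide_eq) (simp_all only: mult.commute)
        have half: "c powr (- 1 / 2) = 1 / sqrt c"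
          using c by (simp add: powr_minus_divide powr_half_sqrt)
        have "real (6 * m * Suc (n div t) * (5 * b)) = 30 * real m * (real (Suc (n div t)) * real b)"
          by (simp only: of_nat_mult of_nat_numeral)
        also have "\<dots> \<le> 30 * real m * ((4 * real n / sqrt c) * (2 * ?ln))"
          using G b_le by (intro mult_left_mono mult_mono) auto
        also have "\<dots> = 240 * (real m * real n * c powr (- 1 / 2) * ?ln) * 1"
          unfolding half by simp
        also have "\<dots> \<le> 240 * (real m * real n * c powr (- 1 / 2) * ?ln) * ?lm"
          using lm ln by (intro mult_left_mono) auto
        finally show ?thesis by (simp add: mult.assoc)
      qed
      moreover have "real (3 * (10 * b + 8) + 15 * b + t * t + 2 * t + 3) \<le> ?v"
      proof -
        \<comment> \<open>The left-hand side is \<open>45 * b + 27 + x + 2 * t\<close>; the constant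
          is absorbed using \<open>1 \<le> b\<close>, and \<open>2 * t\<close> using
          \<open>t \<le> x\<close>.\<close>
        have "3 * (10 * b + 8) + 15 * b + x + 2 * t + 3 \<le> 72 * b + 3 * x" if "t \<le> x" for x
          using that b1 by simp
        then have "3 * (10 * b + 8) + 15 * b + t * t + 2 * t + 3 \<le> 72 * b + 3 * (t * t)"
          by simp
        then have "real (3 * (10 * b + 8) + 15 * b + t * t + 2 * t + 3) \<le> real (72 * b + 3 * (t * t))"
          by (simp only: of_nat_le_iff)
        also have "\<dots> = 72 * real b + 3 * real (t * t)" by simp
        also have "\<dots> \<le> 144 * ?ln + 3 * c" using b_le tt by linarith
        also have "\<dots> \<le> 144 * (c * ?ln) + 3 * (c * ?ln)"
        proof -
          have "1 * ?ln \<le> c * ?ln" "c * 1 \<le> c * ?ln"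
            using c ln by (intro mult_right_mono mult_left_mono; simp)+
          then show ?thesis by simp
        qed
        also have "\<dots> \<le> 240 * (c * ?ln) * 1" using c ln by simp
        also have "\<dots> \<le> 240 * (c * ?ln) * ?lm" using c ln lm by (intro mult_left_mono) auto
        finally show ?thesis by (simp add: mult.assoc)
      qed
      ultimately show ?thesis
        using triangle_scheme[OF nm2(1) nb nm(2) t1 p(1,2)] by blast
    qed
  qed
qed

end
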